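(* There is a universal constant $C>0$ such that the following holds. Let $d\ge 2$, $L>0$, $g>0$, $\rho_+>\rho_->0$, and $A=(\rho_+-\rho_-)/(\rho_++\rho_-)$. Let $(\rho,\mathbf{u})$ be a classical solution on $[0,L]^{d-1}\times\mathbb{R}$ (periodic in the first $d-1$ variables) of the system $$\rho_t+\mathbf{u}\cdot\nabla\rho-\Delta\rho=0,$$ $$\rho\big(\mathbf{u}_t+(\mathbf{u}\cdot\nabla)\mathbf{u}\big)-(\nabla\rho\cdot\nabla)\mathbf{u}+\nabla p+\rho g\,\mathbf{e}_z=0,\qquad \nabla\cdot\mathbf{u}=0,$$ with initial data such that the initial potential energy $E_p(0)$, the initial mixing entropy $H(0)$ and the initial mean perimeter $P(0)$ are finite. Then $$\limsup_{t\to+\infty}\frac{E_p(t)}{A^2g^3t^3}\le C\,\frac{L^2}{(1-A)^{3/2}}\qquad\text{and}\qquad\limsup_{t\to+\infty}\frac{H(t)}{Agt^{3/2}}\le C\,\frac{L}{(1-A)^{3/4}}.$$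
   Context: Points of the strip are $x=(y,z)$ with $y\in[0,L]^{d-1}$, $z\in\mathbb{R}$; $\mathbf{e}_z$ is the unit vector in the $z$ direction; all functions are periodic in $y$. The unknowns are the scalar density $\rho(x,t)$, the velocity $\mathbf{u}(x,t)\in\mathbb{R}^d$, and the pressure $p(x,t)$. Reference state: $\mathbf{u}_0=0$, $\rho_0(z)=\rho_+$ for $z\ge 0$ and $\rho_0(z)=\rho_-$ for $z<0$. Throughout, the initial datum is a perturbation of this reference state. Normalized integral: $⨍ f\,dx=\int_{\mathbb{R}}\frac{1}{L^{d-1}}\int_{[0,L]^{d-1}}f(y,z)\,dy\,dz$ (here ⨍ denotes the integral over the strip divided by $L^{d-1}$). Bulk quantities: $E_p(t)=\frac{1}{\rho_+-\rho_-}⨍(\rho_0(z)-\rho(x,t))\,g z\,dx$ (negative of the potential energy), $E_k(t)=\frac{1}{2(\rho_+-\rho_-)}⨍\rho|\mathbf{u}|^2\,dx$ (kinetic energy), $H(t)=\frac{1}{(\rho_+-\rho_-)^2}⨍(\rho_+-\rho)(\rho-\rho_-)\,dx$ (mixing entropy), $P(t)=\frac{1}{\rho_+-\rho_-}⨍|\nabla\rho|\,dx$ (mean perimeter). Convention on classical solutions: $(\rho,\mathbf{u},p)$ is smooth enough for the equations to hold pointwise for all $t>0$ (so the solution is global in time), periodic in $y$; $\rho\in[\rho_-,\rho_+]$, with $\rho\in(\rho_-,\rho_+)$ for $t>0$; $\rho\to\rho_\pm$ and $|\mathbf{u}|\to0$ as $z\to\pm\infty$; and the decay as $z\to\pm\infty$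 is fast enough that the bulk quantities $E_p,E_k,H$ are finite and continuous for $t\ge0$, differentiable for $t>0$ by differentiating under the integral, and integrations by parts in $z$ produce no boundary terms at infinity other than those coming from $\rho\to\rho_\pm$ in $\int \rho_z\,dz=\rho_+-\rho_-$. *)

theory Defs
  imports "HOL-Analysis.Analysis"
begin

(* The dimension d is a natural number, so that a constant can be chosen before d. A point of R^d
   is an extensional function on {..<d}; the coordinates i < d - 1 are the periodic variables y and
   the coordinate d - 1 is the vertical variable z. The topology used below is the product topology
   of nat \<Rightarrow> real, which on these functions is the Euclidean one. *)

definition points :: "nat \<Rightarrow> (nat \<Rightarrow> real) set" where
  "points d = (\<Pi>\<^sub>E i\<in>{..<d}. UNIV)"

definition strip :: "nat \<Rightarrow> real \<Rightarrow> (nat \<Rightarrow> real) set" where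
  "strip d L = (\<Pi>\<^sub>E i\<in>{..<d}. if i < d - 1 then {0..L} else UNIV)"

abbreviation vol :: "nat \<Rightarrow> (nat \<Rightarrow> real) measure" where
  "vol d \<equiv> \<Pi>\<^sub>M i\<in>{..<d}. lborel"

definition strip_integrable :: "nat \<Rightarrow> real \<Rightarrow> ((nat \<Rightarrow> real) \<Rightarrow> real) \<Rightarrow> bool" where
  "strip_integrable d L f \<longleftrightarrow> set_integrable (vol d) (strip d L) f"

definition strip_avg :: "nat \<Rightarrow> real \<Rightarrow> ((nat \<Rightarrow> real) \<Rightarrow> real) \<Rightarrow> real" where
  "strip_avg d L f = (1 / L ^ (d - 1)) * (LINT x:strip d L|vol d. f x)"

definition slice_avg :: "nat \<Rightarrow> real \<Rightarrow> ((nat \<Rightarrow> real) \<Rightarrow> real) \<Rightarrow> real \<Rightarrow> real" where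
  "slice_avg d L f z =
     (1 / L ^ (d - 1)) * (LINT y:(\<Pi>\<^sub>E i\<in>{..<d - 1}. {0..L})|vol (d - 1). f (y(d - 1 := z)))"

definition y_periodic :: "nat \<Rightarrow> real \<Rightarrow> ((nat \<Rightarrow> real) \<Rightarrow> real) \<Rightarrow> bool" where
  "y_periodic d L f \<longleftrightarrow> (\<forall>x\<in>points d. \<forall>i<d - 1. f (x(i := x i + L)) = f x)"

definition pd_exists :: "nat \<Rightarrow> ((nat \<Rightarrow> real) \<Rightarrow> real) \<Rightarrow> (nat \<Rightarrow> real) \<Rightarrow> bool" where
  "pd_exists i f x \<longleftrightarrow> (\<lambda>s. f (x(i := s))) differentiable (at (x i))"

definition pd :: "nat \<Rightarrow> ((nat \<Rightarrow> real) \<Rightarrow> real) \<Rightarrow> (nat \<Rightarrow> real) \<Rightarrow> real" where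
  "pd i f x = deriv (\<lambda>s. f (x(i := s))) (x i)"

definition td :: "(real \<Rightarrow> (nat \<Rightarrow> real) \<Rightarrow> real) \<Rightarrow> real \<Rightarrow> (nat \<Rightarrow> real) \<Rightarrow> real" where
  "td f t x = deriv (\<lambda>s. f s x) t"

definition ref_density :: "real \<Rightarrow> real \<Rightarrow> real \<Rightarrow> real" where
  "ref_density \<rho>m \<rho>p z = (if z \<ge> 0 then \<rho>p else \<rho>m)"

definition potential_density ::
  "nat \<Rightarrow> real \<Rightarrow> real \<Rightarrow> real \<Rightarrow> (real \<Rightarrow> (nat \<Rightarrow> real) \<Rightarrow> real) \<Rightarrow> real \<Rightarrow> (nat \<Rightarrow> real) \<Rightarrow> real" where
  "potential_density d g \<rho>m \<rho>p \<rho> t x =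
     (ref_density \<rho>m \<rho>p (x (d - 1)) - \<rho> t x) * g * x (d - 1)"

definition kinetic_density ::
  "nat \<Rightarrow> (real \<Rightarrow> (nat \<Rightarrow> real) \<Rightarrow> real) \<Rightarrow> (real \<Rightarrow> (nat \<Rightarrow> real) \<Rightarrow> nat \<Rightarrow> real) \<Rightarrow>
   real \<Rightarrow> (nat \<Rightarrow> real) \<Rightarrow> real" where
  "kinetic_density d \<rho> u t x = \<rho> t x * (L2_set (u t x) {..<d})\<^sup>2"

definition mixing_density ::
  "real \<Rightarrow> real \<Rightarrow> (real \<Rightarrow> (nat \<Rightarrow> real) \<Rightarrow> real) \<Rightarrow> real \<Rightarrow> (nat \<Rightarrow> real) \<Rightarrow> real" where
  "mixing_density \<rho>m \<rho>p \<rho> t x = (\<rho>p - \<rho> t x) * (\<rho> t x - \<rho>m)"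

definition Ep ::
  "nat \<Rightarrow> real \<Rightarrow> real \<Rightarrow> real \<Rightarrow> real \<Rightarrow> (real \<Rightarrow> (nat \<Rightarrow> real) \<Rightarrow> real) \<Rightarrow> real \<Rightarrow> real" where
  "Ep d L g \<rho>m \<rho>p \<rho> t = (1 / (\<rho>p - \<rho>m)) * strip_avg d L (potential_density d g \<rho>m \<rho>p \<rho> t)"

definition Ek ::
  "nat \<Rightarrow> real \<Rightarrow> real \<Rightarrow> real \<Rightarrow> (real \<Rightarrow> (nat \<Rightarrow> real) \<Rightarrow> real) \<Rightarrow>
   (real \<Rightarrow> (nat \<Rightarrow> real) \<Rightarrow> nat \<Rightarrow> real) \<Rightarrow> real \<Rightarrow> real" where
  "Ek d L \<rho>m \<rho>p \<rho> u t = (1 / (2 * (\<rho>p - \<rho>m))) * strip_avg d L (kinetic_density d \<rho> u t)"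

definition Hmix ::
  "nat \<Rightarrow> real \<Rightarrow> real \<Rightarrow> real \<Rightarrow> (real \<Rightarrow> (nat \<Rightarrow> real) \<Rightarrow> real) \<Rightarrow> real \<Rightarrow> real" where
  "Hmix d L \<rho>m \<rho>p \<rho> t = (1 / (\<rho>p - \<rho>m)\<^sup>2) * strip_avg d L (mixing_density \<rho>m \<rho>p \<rho> t)"

(* The equations are only imposed for t > 0 and the initial density may have sharp interfaces (as
   the reference state does). The integral of |grad rho| is therefore the total variation of the
   vector measure grad rho on the strip, with y periodic, defined by duality as for functions of
   bounded variation; for smooth rho it is the integral of the pointwise |grad rho|. *)

definition test_fields :: "nat \<Rightarrow> real \<Rightarrow> ((nat \<Rightarrow> real) \<Rightarrow> nat \<Rightarrow> real) set" where
  "test_fields d L = {\<phi>.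
     (\<forall>j<d. y_periodic d L (\<lambda>x. \<phi> x j)) \<and>
     (\<exists>R. \<forall>x\<in>points d. \<bar>x (d - 1)\<bar> > R \<longrightarrow> (\<forall>j<d. \<phi> x j = 0)) \<and>
     (\<forall>x\<in>points d. L2_set (\<phi> x) {..<d} \<le> 1) \<and>
     (\<forall>i<d. \<forall>j<d. (\<forall>x\<in>points d. pd_exists i (\<lambda>x. \<phi> x j) x) \<and>
        continuous_on (points d) (pd i (\<lambda>x. \<phi> x j)))}"

definition mean_perimeter ::
  "nat \<Rightarrow> real \<Rightarrow> real \<Rightarrow> real \<Rightarrow> (real \<Rightarrow> (nat \<Rightarrow> real) \<Rightarrow> real) \<Rightarrow> real \<Rightarrow> ereal" where
  "mean_perimeter d L \<rho>m \<rho>p \<rho> t = (SUP \<phi>\<in>test_fields d L.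
     ereal ((1 / (\<rho>p - \<rho>m)) * strip_avg d L (\<lambda>x. \<rho> t x * (\<Sum>i<d. pd i (\<lambda>x. \<phi> x i) x))))"

definition solution_regular ::
  "nat \<Rightarrow> (real \<Rightarrow> (nat \<Rightarrow> real) \<Rightarrow> real) \<Rightarrow> (real \<Rightarrow> (nat \<Rightarrow> real) \<Rightarrow> nat \<Rightarrow> real) \<Rightarrow>
   (real \<Rightarrow> (nat \<Rightarrow> real) \<Rightarrow> real) \<Rightarrow> bool" where
  "solution_regular d \<rho> u p \<longleftrightarrow>
     (\<forall>t>0. \<forall>x\<in>points d.
        (\<lambda>s. \<rho> s x) differentiable (at t) \<and>
        (\<forall>i<d. pd_exists i (\<rho> t) x \<and> pd_exists i (pd i (\<rho> t)) x \<and> pd_exists i (p t) x) \<and>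
        (\<forall>j<d. (\<lambda>s. u s x j) differentiable (at t) \<and>
           (\<forall>i<d. pd_exists i (\<lambda>x. u t x j) x))) \<and>
     continuous_on ({0<..} \<times> points d) (\<lambda>(t, x). td \<rho> t x) \<and>
     (\<forall>i<d. continuous_on ({0<..} \<times> points d) (\<lambda>(t, x). pd i (\<rho> t) x) \<and>
        continuous_on ({0<..} \<times> points d) (\<lambda>(t, x). pd i (pd i (\<rho> t)) x) \<and>
        continuous_on ({0<..} \<times> points d) (\<lambda>(t, x). pd i (p t) x)) \<and>
     (\<forall>j<d. continuous_on ({0<..} \<times> points d) (\<lambda>(t, x). td (\<lambda>t x. u t x j) t x) \<and>
        (\<forall>i<d. continuous_on ({0<..} \<times> points d) (\<lambda>(t, x). pd i (\<lambda>x. u t x j) x)))"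

definition solution_periodic ::
  "nat \<Rightarrow> real \<Rightarrow> (real \<Rightarrow> (nat \<Rightarrow> real) \<Rightarrow> real) \<Rightarrow> (real \<Rightarrow> (nat \<Rightarrow> real) \<Rightarrow> nat \<Rightarrow> real) \<Rightarrow>
   (real \<Rightarrow> (nat \<Rightarrow> real) \<Rightarrow> real) \<Rightarrow> bool" where
  "solution_periodic d L \<rho> u p \<longleftrightarrow>
     (\<forall>t\<ge>0. y_periodic d L (\<rho> t) \<and> (\<forall>j<d. y_periodic d L (\<lambda>x. u t x j))) \<and>
     (\<forall>t>0. y_periodic d L (p t))"

definition transport_equation ::
  "nat \<Rightarrow> (real \<Rightarrow> (nat \<Rightarrow> real) \<Rightarrow> real) \<Rightarrow> (real \<Rightarrow> (nat \<Rightarrow> real) \<Rightarrow> nat \<Rightarrow> real) \<Rightarrow> bool" where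
  "transport_equation d \<rho> u \<longleftrightarrow> (\<forall>t>0. \<forall>x\<in>points d.
     td \<rho> t x + (\<Sum>i<d. u t x i * pd i (\<rho> t) x) - (\<Sum>i<d. pd i (pd i (\<rho> t)) x) = 0)"

definition momentum_equation ::
  "nat \<Rightarrow> real \<Rightarrow> (real \<Rightarrow> (nat \<Rightarrow> real) \<Rightarrow> real) \<Rightarrow> (real \<Rightarrow> (nat \<Rightarrow> real) \<Rightarrow> nat \<Rightarrow> real) \<Rightarrow>
   (real \<Rightarrow> (nat \<Rightarrow> real) \<Rightarrow> real) \<Rightarrow> bool" where
  "momentum_equation d g \<rho> u p \<longleftrightarrow> (\<forall>t>0. \<forall>x\<in>points d. \<forall>j<d.
     \<rho> t x * (td (\<lambda>t x. u t x j) t x + (\<Sum>i<d. u t x i * pd i (\<lambda>x. u t x j) x))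
     - (\<Sum>i<d. pd i (\<rho> t) x * pd i (\<lambda>x. u t x j) x)
     + pd j (p t) x + \<rho> t x * g * (if j = d - 1 then 1 else 0) = 0)"

definition incompressible ::
  "nat \<Rightarrow> (real \<Rightarrow> (nat \<Rightarrow> real) \<Rightarrow> nat \<Rightarrow> real) \<Rightarrow> bool" where
  "incompressible d u \<longleftrightarrow> (\<forall>t>0. \<forall>x\<in>points d. (\<Sum>i<d. pd i (\<lambda>x. u t x i) x) = 0)"

definition density_range ::
  "nat \<Rightarrow> real \<Rightarrow> real \<Rightarrow> (real \<Rightarrow> (nat \<Rightarrow> real) \<Rightarrow> real) \<Rightarrow> bool" where
  "density_range d \<rho>m \<rho>p \<rho> \<longleftrightarrow>
     (\<forall>t\<ge>0. \<forall>x\<in>points d. \<rho> t x \<in> {\<rho>m..\<rho>p}) \<and>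
     (\<forall>t>0. \<forall>x\<in>points d. \<rho> t x \<in> {\<rho>m<..<\<rho>p})"

definition far_field ::
  "nat \<Rightarrow> real \<Rightarrow> real \<Rightarrow> (real \<Rightarrow> (nat \<Rightarrow> real) \<Rightarrow> real) \<Rightarrow>
   (real \<Rightarrow> (nat \<Rightarrow> real) \<Rightarrow> nat \<Rightarrow> real) \<Rightarrow> bool" where
  "far_field d \<rho>m \<rho>p \<rho> u \<longleftrightarrow> (\<forall>t\<ge>0. \<forall>x\<in>points d.
     ((\<lambda>z. \<rho> t (x(d - 1 := z))) \<longlongrightarrow> \<rho>p) at_top \<and>
     ((\<lambda>z. \<rho> t (x(d - 1 := z))) \<longlongrightarrow> \<rho>m) at_bot \<and>
     ((\<lambda>z. L2_set (u t (x(d - 1 := z))) {..<d}) \<longlongrightarrow> 0) at_top \<and>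
     ((\<lambda>z. L2_set (u t (x(d - 1 := z))) {..<d}) \<longlongrightarrow> 0) at_bot)"

definition regular_bulk ::
  "nat \<Rightarrow> real \<Rightarrow> (real \<Rightarrow> (nat \<Rightarrow> real) \<Rightarrow> real) \<Rightarrow> bool" where
  "regular_bulk d L f \<longleftrightarrow>
     (\<forall>t\<ge>0. strip_integrable d L (f t)) \<and>
     continuous_on {0..} (\<lambda>t. strip_avg d L (f t)) \<and>
     (\<forall>t>0. strip_integrable d L (td f t) \<and>
        ((\<lambda>s. strip_avg d L (f s)) has_real_derivative strip_avg d L (td f t)) (at t))"

definition no_flux_at_infinity :: "nat \<Rightarrow> real \<Rightarrow> ((nat \<Rightarrow> real) \<Rightarrow> real) \<Rightarrow> bool" where
  "no_flux_at_infinity d L F \<longleftrightarrow>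
     (slice_avg d L F \<longlongrightarrow> 0) at_top \<and> (slice_avg d L F \<longlongrightarrow> 0) at_bot"

(* When the time derivatives of the three bulk quantities are computed from the equations, the
   integrations by parts in z leave boundary integrals over the slices z = const. The vertical
   fluxes concerned are, in order, those of the potential energy (with the weight z), of the kinetic
   energy, and of the mixing entropy; each has a diffusive and a convective part, and the kinetic
   energy also has the pressure work. The remaining boundary term, that of the integral of rho_z,
   is determined by far_field. *)

definition no_boundary_terms ::
  "nat \<Rightarrow> real \<Rightarrow> real \<Rightarrow> real \<Rightarrow> (real \<Rightarrow> (nat \<Rightarrow> real) \<Rightarrow> real) \<Rightarrow>
   (real \<Rightarrow> (nat \<Rightarrow> real) \<Rightarrow> nat \<Rightarrow> real) \<Rightarrow> (real \<Rightarrow> (nat \<Rightarrow> real) \<Rightarrow> real) \<Rightarrow> bool" where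
  "no_boundary_terms d L \<rho>m \<rho>p \<rho> u p \<longleftrightarrow> (\<forall>t>0.
     no_flux_at_infinity d L (\<lambda>x. x (d - 1) * pd (d - 1) (\<rho> t) x) \<and>
     no_flux_at_infinity d L (\<lambda>x. x (d - 1) * \<rho> t x * u t x (d - 1)) \<and>
     no_flux_at_infinity d L (\<lambda>x. (L2_set (u t x) {..<d})\<^sup>2 * pd (d - 1) (\<rho> t) x) \<and>
     no_flux_at_infinity d L (\<lambda>x. (L2_set (u t x) {..<d})\<^sup>2 * \<rho> t x * u t x (d - 1)) \<and>
     no_flux_at_infinity d L (\<lambda>x. p t x * u t x (d - 1)) \<and>
     no_flux_at_infinity d L (\<lambda>x. (\<rho>p + \<rho>m - 2 * \<rho> t x) * pd (d - 1) (\<rho> t) x) \<and>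
     no_flux_at_infinity d L (\<lambda>x. (\<rho>p - \<rho> t x) * (\<rho> t x - \<rho>m) * u t x (d - 1)))"

definition classical_solution ::
  "nat \<Rightarrow> real \<Rightarrow> real \<Rightarrow> real \<Rightarrow> real \<Rightarrow> (real \<Rightarrow> (nat \<Rightarrow> real) \<Rightarrow> real) \<Rightarrow>
   (real \<Rightarrow> (nat \<Rightarrow> real) \<Rightarrow> nat \<Rightarrow> real) \<Rightarrow> (real \<Rightarrow> (nat \<Rightarrow> real) \<Rightarrow> real) \<Rightarrow> bool" where
  "classical_solution d L g \<rho>m \<rho>p \<rho> u p \<longleftrightarrow>
     solution_regular d \<rho> u p \<and>
     solution_periodic d L \<rho> u p \<and>
     transport_equation d \<rho> u \<and>
     momentum_equation d g \<rho> u p \<and>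
     incompressible d u \<and>
     density_range d \<rho>m \<rho>p \<rho> \<and>
     far_field d \<rho>m \<rho>p \<rho> u \<and>
     regular_bulk d L (potential_density d g \<rho>m \<rho>p \<rho>) \<and>
     regular_bulk d L (kinetic_density d \<rho> u) \<and>
     regular_bulk d L (mixing_density \<rho>m \<rho>p \<rho>) \<and>
     no_boundary_terms d L \<rho>m \<rho>p \<rho> u p"

end

theory Submission
  imports Defs "HOL-Probability.Infinite_Product_Measure"
begin

text \<open>Write \<open>X\<close>, \<open>E\<close>, \<open>H\<close> for the integrals of the potential, kinetic and mixing densities, \<open>\<Delta>\<close> for the density
  jump and \<open>W\<close> for the integral of \<open>\<rho> u\<^sub>z\<close> (a limit of integrals over boxes). The equations give
  \<open>X' = g (\<Delta> - W)\<close>, \<open>E' = - 2 g W\<close> and \<open>H' = 2 \<integral> |\<nabla>\<rho>|\<^sup>2\<close>; in particular \<open>2 X - E - 2 g \<Delta> t\<close> is constant.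
  On every horizontal slice \<open>u\<^sub>z\<close> has mean zero, so \<open>\<rho>\<close> may be replaced there by its deviation from the
  slice mean, and the Poincare inequality on the slice bounds \<open>W\<close> by a multiple of
  \<open>L \<surd>(H' E)\<close>. Since mixing far from the interface costs potential energy, \<open>H\<close> is at most a
  multiple of \<open>\<surd>X\<close>. Integrating the resulting bound for \<open>(\<surd>E)'\<close> and using \<open>X \<approx> E / 2 + g \<Delta> t\<close> yields
  \<open>X = O(t\<^sup>2)\<close> and \<open>H = O(t)\<close>, so both upper limits vanish.\<close>

subsection \<open>Variance under product measures\<close>

text \<open>The hypotheses make only the three bulk densities and their time derivatives integrable
  over the strip; \<open>\<rho> t x * u t x n\<close>, the squared gradient and the separate terms
  of the equations come without integrability. Every identity is therefore proved on boxes of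
  bounded height, with explicit fluxes through top and bottom, and only then passed to the limit.
  The kinetic energy identity contains no dissipation, because the term (grad \<rho> . grad) u of
  the momentum equation and the Laplacian in the transport equation combine into a divergence. This
  is what ties \<open>X\<close> and \<open>E\<close> together by a conservation law. The growth
  estimate closes at each single time, without a Gronwall argument: \<open>H\<close> enters the
  bound for the square root of \<open>E\<close> linearly, and is itself bounded by that root plus a
  multiple of t. The coefficient of the root that comes back is made 1/2 by the free weight in
  Young's inequality. The Poincare inequality on the cube comes from an Efron-Stein bound on the
  variance, which reduces it to increments along edges and gives a constant independent of the
  dimension.\<close>

lemma (in prob_space) variance_le_second_moment:
  fixes h :: "'a \<Rightarrow> real"
  assumes [measurable]: "h \<in> borel_measurable M" and B: "\<And>x. x \<in> space M \<Longrightarrow> \<bar>h x\<bar> \<le> B"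
  shows "(\<integral>x. (h x)\<^sup>2 \<partial>M) - (\<integral>x. h x \<partial>M)\<^sup>2 \<le> (\<integral>x. (h x - c)\<^sup>2 \<partial>M)"
proof -
  have i1: "integrable M h"
    by (rule integrable_const_bound[of _ B]) (use B in auto)
  have i2: "integrable M (\<lambda>x. (h x)\<^sup>2)"
    by (rule integrable_const_bound[of _ "B\<^sup>2"]) (use B abs_le_square_iff in \<open>fastforce intro!: AE_I2\<close>, simp)
  have "(\<integral>x. (h x - c)\<^sup>2 \<partial>M) = (\<integral>x. (h x)\<^sup>2 - 2 * c * h x + c\<^sup>2 \<partial>M)"
    by (simp add: power2_diff algebra_simps)
  also have "\<dots> = (\<integral>x. (h x)\<^sup>2 \<partial>M) - 2 * c * (\<integral>x. h x \<partial>M) + c\<^sup>2"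
    using i1 i2 by (simp add: prob_space)
  moreover have "((\<integral>x. h x \<partial>M) - c)\<^sup>2 \<ge> 0" by simp
  ultimately show ?thesis by (simp add: power2_eq_square algebra_simps)
qed

text \<open>Only finite differences of \<open>f\<close> enter, so averaging \<open>f\<close> over one coordinate preserves the
  hypotheses and no differentiation under the integral is needed.\<close>

lemma variance_le_sum_oscillation:
  fixes f :: "('i \<Rightarrow> 'a) \<Rightarrow> real" and K :: "'i \<Rightarrow> ('i \<Rightarrow> 'a) \<Rightarrow> ennreal"
  assumes M: "\<And>i. prob_space (M i)" and "finite J"
    and "f \<in> borel_measurable (PiM J M)"
    and "\<And>x. x \<in> space (PiM J M) \<Longrightarrow> \<bar>f x\<bar> \<le> B"
    and S: "\<And>i. S i \<subseteq> space (M i)" "\<And>i. AE s in M i. s \<in> S i"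
    and "\<And>j. j \<in> J \<Longrightarrow> K j \<in> borel_measurable (PiM J M)"
    and "\<And>j x s s'. \<lbrakk>j \<in> J; x \<in> (\<Pi>\<^sub>E i\<in>J. S i); s \<in> S j; s' \<in> S j\<rbrakk>
           \<Longrightarrow> ennreal ((f (x(j := s)) - f (x(j := s')))\<^sup>2) \<le> K j x"
  shows "ennreal ((\<integral>x. (f x)\<^sup>2 \<partial>PiM J M) - (\<integral>x. f x \<partial>PiM J M)\<^sup>2)
           \<le> (\<Sum>j\<in>J. \<integral>\<^sup>+x. K j x \<partial>PiM J M)"
  using assms(2-4,7,8)
proof (induction J arbitrary: f K)
  case empty
  show ?case
    by (simp add: PiM_empty lebesgue_integral_count_space_finite)
next
  case (insert i I)
  note fm[measurable] = insert.prems(1) and B = insert.prems(2) and Km = insert.prems(3)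
    and osc = insert.prems(4)
  interpret I: prob_space "PiM I M" by (rule prob_space_PiM[OF M])
  interpret i: prob_space "M i" by (rule M)
  interpret J: prob_space "PiM (insert i I) M" by (rule prob_space_PiM[OF M])
  interpret product_sigma_finite M
    by (intro product_sigma_finite.intro prob_space_imp_sigma_finite M)
  \<comment> \<open>Conditional mean and conditional second moment given the other coordinates;
    \<open>G - F\<^sup>2\<close> is the conditional variance.\<close>
  define F where "F x = (\<integral>r. f (x(i := r)) \<partial>M i)" for x
  define G where "G x = (\<integral>r. (f (x(i := r)))\<^sup>2 \<partial>M i)" for x
  have upd[measurable]: "(\<lambda>(x, r). x(i := r)) \<in> PiM I M \<Otimes>\<^sub>M M i \<rightarrow>\<^sub>M PiM (insert i I) M"
    by (rule measurable_add_dim)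
  have fm2[measurable]: "(\<lambda>(x, r). f (x(i := r))) \<in> borel_measurable (PiM I M \<Otimes>\<^sub>M M i)"
    using measurable_compose[OF upd fm] by (simp add: case_prod_unfold)
  have fm1[measurable]: "(\<lambda>r. f (x(i := r))) \<in> borel_measurable (M i)" if "x \<in> space (PiM I M)" for x
    using measurable_compose[OF _ fm2, of "\<lambda>r. (x, r)" "M i"] that by simp
  have Fm[measurable]: "F \<in> borel_measurable (PiM I M)" unfolding F_def by measurable
  have Gm[measurable]: "G \<in> borel_measurable (PiM I M)" unfolding G_def by measurable
  have sp: "x(i := r) \<in> space (PiM (insert i I) M)"
    if "x \<in> space (PiM I M)" "r \<in> space (M i)" for x r
    using that by (auto simp: space_PiM PiE_def extensional_def)
  have Bf: "\<bar>f (x(i := r))\<bar> \<le> B" if "x \<in> space (PiM I M)" "r \<in> space (M i)" for x r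
    by (rule B[OF sp[OF that]])
  obtain x0 where "x0 \<in> space (PiM (insert i I) M)" using J.not_empty by blast
  then have B0: "B \<ge> 0" using B by fastforce
  have sqB: "\<bar>y\<bar> \<le> B \<Longrightarrow> y\<^sup>2 \<le> B\<^sup>2" for y :: real
    using B0 by (simp add: abs_le_square_iff[symmetric])
  have int_r: "integrable (M i) (\<lambda>r. f (x(i := r)))" if "x \<in> space (PiM I M)" for x
    by (rule i.integrable_const_bound[of _ B]) (use Bf that in auto)
  have int_r2: "integrable (M i) (\<lambda>r. (f (x(i := r)))\<^sup>2)" if "x \<in> space (PiM I M)" for x
    by (rule i.integrable_const_bound[of _ "B\<^sup>2"]) (use Bf sqB that in auto)
  have BF: "\<bar>F x\<bar> \<le> B" if "x \<in> space (PiM I M)" for x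
  proof -
    have "F x \<le> B" unfolding F_def
      by (rule i.integral_le_const[OF int_r[OF that]]) (use Bf[OF that] in \<open>auto simp: abs_le_iff\<close>)
    moreover have "F x \<ge> -B" unfolding F_def
      by (rule i.integral_ge_const[OF int_r[OF that]]) (use Bf[OF that] in \<open>auto simp: abs_le_iff minus_le_iff\<close>)
    ultimately show ?thesis by simp
  qed
  have BG: "G x \<le> B\<^sup>2" if "x \<in> space (PiM I M)" for x
    unfolding G_def by (rule i.integral_le_const[OF int_r2[OF that]]) (use Bf[OF that] sqB in auto)
  have G0: "G x \<ge> 0" for x unfolding G_def by simp
  have GF: "(F x)\<^sup>2 \<le> G x" if "x \<in> space (PiM I M)" for x
  proof -
    have "(\<integral>r. (f (x(i := r)) - F x)\<^sup>2 \<partial>M i) \<ge> 0" by simp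
    moreover have "(\<integral>r. (f (x(i := r)) - F x)\<^sup>2 \<partial>M i) = G x - (F x)\<^sup>2"
      using int_r[OF that] int_r2[OF that]
      by (simp add: power2_diff i.prob_space F_def[symmetric] G_def[symmetric])
         (simp add: power2_eq_square)
    ultimately show ?thesis by simp
  qed
  have intF: "integrable (PiM I M) F"
    by (rule I.integrable_const_bound[of _ B]) (use BF in auto)
  have intF2: "integrable (PiM I M) (\<lambda>x. (F x)\<^sup>2)"
    by (rule I.integrable_const_bound[of _ "B\<^sup>2"]) (use BF sqB in auto)
  have intG: "integrable (PiM I M) G"
    by (rule I.integrable_const_bound[of _ "B\<^sup>2"]) (use BG G0 in auto)
  have e1: "(\<integral>x. f x \<partial>PiM (insert i I) M) = (\<integral>x. F x \<partial>PiM I M)"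
    unfolding F_def using insert.hyps
    by (intro product_integral_insert J.integrable_const_bound[of _ B]) (use B in auto)
  have e2: "(\<integral>x. (f x)\<^sup>2 \<partial>PiM (insert i I) M) = (\<integral>x. G x \<partial>PiM I M)"
    unfolding G_def using insert.hyps
    by (intro product_integral_insert J.integrable_const_bound[of _ "B\<^sup>2"]) (use B sqB in auto)
  \<comment> \<open>Law of total variance: the mean of the conditional variance plus the variance of
    the conditional mean.\<close>
  have split: "(\<integral>x. (f x)\<^sup>2 \<partial>PiM (insert i I) M) - (\<integral>x. f x \<partial>PiM (insert i I) M)\<^sup>2
     = (\<integral>x. G x - (F x)\<^sup>2 \<partial>PiM I M) + ((\<integral>x. (F x)\<^sup>2 \<partial>PiM I M) - (\<integral>x. F x \<partial>PiM I M)\<^sup>2)"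
    unfolding e1 e2 using intF2 intG by simp
  have AEI: "AE x in PiM I M. x \<in> (\<Pi>\<^sub>E i\<in>I. S i)"
  proof -
    have "AE x in PiM I M. \<forall>j\<in>I. x j \<in> S j"
      using insert.hyps S(2)
      by (intro AE_finite_allI AE_PiM_component) (auto intro: M)
    then show ?thesis using AE_space
      by eventually_elim (auto simp: PiE_def space_PiM)
  qed
  have first: "ennreal (\<integral>x. G x - (F x)\<^sup>2 \<partial>PiM I M) \<le> (\<integral>\<^sup>+x. K i x \<partial>PiM (insert i I) M)"
  proof -
    \<comment> \<open>A single point of \<open>S i\<close> suffices as comparison value, since
      replacing the mean by another constant only increases the mean square deviation. Such a point
      exists because \<open>S i\<close> carries the full mass of a probability measure.\<close>
    have "\<exists>s. s \<in> S i"
    proof (rule ccontr)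
      assume "\<not> ?thesis"
      then have "AE s in M i. False" using S(2)[of i] by simp
      then show False using i.AE_False by blast
    qed
    then obtain s0 where s0: "s0 \<in> S i" by blast
    have "ennreal (\<integral>x. G x - (F x)\<^sup>2 \<partial>PiM I M) = (\<integral>\<^sup>+x. ennreal (G x - (F x)\<^sup>2) \<partial>PiM I M)"
      using intF2 intG GF by (intro nn_integral_eq_integral[symmetric]) auto
    also have "\<dots> \<le> (\<integral>\<^sup>+x. (\<integral>\<^sup>+r. K i (x(i := r)) \<partial>M i) \<partial>PiM I M)"
    proof (rule nn_integral_mono_AE)
      show "AE x in PiM I M. ennreal (G x - (F x)\<^sup>2) \<le> (\<integral>\<^sup>+r. K i (x(i := r)) \<partial>M i)"
        using AEI AE_space
      proof eventually_elim
        fix x assume x: "x \<in> (\<Pi>\<^sub>E i\<in>I. S i)" and xs: "x \<in> space (PiM I M)"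
        have xu: "x(i := r) \<in> (\<Pi>\<^sub>E i\<in>insert i I. S i)" if "r \<in> S i" for r
          using x that by (auto simp: PiE_def extensional_def)
        have "G x - (F x)\<^sup>2 \<le> (\<integral>r. (f (x(i := r)) - f (x(i := s0)))\<^sup>2 \<partial>M i)"
          unfolding F_def G_def
          by (rule i.variance_le_second_moment[of _ B]) (use xs Bf in auto)
        also have "ennreal \<dots> = (\<integral>\<^sup>+r. ennreal ((f (x(i := r)) - f (x(i := s0)))\<^sup>2) \<partial>M i)"
        proof (rule nn_integral_eq_integral[symmetric])
          show "integrable (M i) (\<lambda>r. (f (x(i := r)) - f (x(i := s0)))\<^sup>2)"
            unfolding power2_diff using int_r[OF xs] int_r2[OF xs] by auto
        qed simp
        also have "\<dots> \<le> (\<integral>\<^sup>+r. K i (x(i := r)) \<partial>M i)"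
        proof (rule nn_integral_mono_AE)
          show "AE r in M i. ennreal ((f (x(i := r)) - f (x(i := s0)))\<^sup>2) \<le> K i (x(i := r))"
            using S(2)[of i]
          proof eventually_elim
            fix r assume r: "r \<in> S i"
            show "ennreal ((f (x(i := r)) - f (x(i := s0)))\<^sup>2) \<le> K i (x(i := r))"
              using osc[OF insertI1 xu[OF r] r s0] by (simp only: fun_upd_upd)
          qed
        qed
        finally show "ennreal (G x - (F x)\<^sup>2) \<le> (\<integral>\<^sup>+r. K i (x(i := r)) \<partial>M i)"
          by (simp add: ennreal_leI)
      qed
    qed
    also have "\<dots> = (\<integral>\<^sup>+x. K i x \<partial>PiM (insert i I) M)"
      using insert.hyps Km by (intro product_nn_integral_insert[symmetric]) auto
    finally show ?thesis .
  qed
  have second: "ennreal ((\<integral>x. (F x)\<^sup>2 \<partial>PiM I M) - (\<integral>x. F x \<partial>PiM I M)\<^sup>2)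
      \<le> (\<Sum>j\<in>I. \<integral>\<^sup>+x. (\<integral>\<^sup>+r. K j (x(i := r)) \<partial>M i) \<partial>PiM I M)"
  \<comment> \<open>The induction hypothesis is applied to the conditional mean \<open>F\<close>,
    with every \<open>K j\<close> averaged over coordinate \<open>i\<close>.\<close>
  proof (rule insert.IH)
    fix j assume "j \<in> I"
    then have [measurable]: "K j \<in> borel_measurable (PiM (insert i I) M)" using Km by auto
    have "(\<lambda>(x, r). K j (x(i := r))) \<in> borel_measurable (PiM I M \<Otimes>\<^sub>M M i)"
      using measurable_compose[OF upd, of "K j"] by (simp add: case_prod_unfold)
    then show "(\<lambda>x. \<integral>\<^sup>+r. K j (x(i := r)) \<partial>M i) \<in> borel_measurable (PiM I M)"
      by measurable
  next
    fix j x s s' assume j: "j \<in> I" and x: "x \<in> (\<Pi>\<^sub>E i\<in>I. S i)" and s: "s \<in> S j" "s' \<in> S j"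
    have ij: "i \<noteq> j" using insert.hyps j by auto
    have xs: "x(j := t) \<in> space (PiM I M)" if "t \<in> S j" for t
      using x that S(1) j by (fastforce simp: PiE_def extensional_def space_PiM Pi_def)
    let ?a = "\<lambda>r. f (x(j := s, i := r))" and ?b = "\<lambda>r. f (x(j := s', i := r))"
    have ia: "integrable (M i) ?a" "integrable (M i) ?b"
      using int_r[OF xs] s by auto
    have iab: "integrable (M i) (\<lambda>r. (?a r - ?b r)\<^sup>2)"
    proof (rule i.integrable_const_bound[of _ "(2 * B)\<^sup>2"])
      show "AE r in M i. norm ((?a r - ?b r)\<^sup>2) \<le> (2 * B)\<^sup>2"
      proof (rule AE_I2)
        fix r assume "r \<in> space (M i)"
        then have "\<bar>?a r\<bar> \<le> B" "\<bar>?b r\<bar> \<le> B" using Bf xs s by auto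
        then have "\<bar>?a r - ?b r\<bar> \<le> \<bar>2 * B\<bar>" by linarith
        then show "norm ((?a r - ?b r)\<^sup>2) \<le> (2 * B)\<^sup>2" by (simp only: real_norm_def abs_power2 abs_le_square_iff)
      qed
      show "(\<lambda>r. (?a r - ?b r)\<^sup>2) \<in> borel_measurable (M i)"
        using ia by (intro borel_measurable_power borel_measurable_diff) auto
    qed
    \<comment> \<open>Jensen's inequality for the square: expanding this nonnegative variance shows
      that the squared mean of the differences is at most the mean of their squares.\<close>
    have "(\<integral>r. ((?a r - ?b r) - (F (x(j := s)) - F (x(j := s'))))\<^sup>2 \<partial>M i) \<ge> 0" by simp
    moreover have "(\<integral>r. ((?a r - ?b r) - (F (x(j := s)) - F (x(j := s'))))\<^sup>2 \<partial>M i)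
        = (\<integral>r. (?a r - ?b r)\<^sup>2 \<partial>M i) - (F (x(j := s)) - F (x(j := s')))\<^sup>2"
    proof -
      define c where "c = F (x(j := s)) - F (x(j := s'))"
      have c: "(\<integral>r. ?a r - ?b r \<partial>M i) = c" using ia by (simp add: c_def F_def)
      have "(\<integral>r. ((?a r - ?b r) - c)\<^sup>2 \<partial>M i) = (\<integral>r. (?a r - ?b r)\<^sup>2 - 2 * c * (?a r - ?b r) + c\<^sup>2 \<partial>M i)"
        by (rule Bochner_Integration.integral_cong) (simp_all add: power2_eq_square algebra_simps)
      also have "\<dots> = (\<integral>r. (?a r - ?b r)\<^sup>2 \<partial>M i) - 2 * c * c + c\<^sup>2"
        using iab ia c by (simp add: i.prob_space del: Bochner_Integration.integral_diff)
           (simp add: c)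
      finally show ?thesis by (simp add: c_def power2_eq_square)
    qed
    ultimately have "(F (x(j := s)) - F (x(j := s')))\<^sup>2 \<le> (\<integral>r. (?a r - ?b r)\<^sup>2 \<partial>M i)" by linarith
    also have "ennreal \<dots> = (\<integral>\<^sup>+r. ennreal ((?a r - ?b r)\<^sup>2) \<partial>M i)"
      by (rule nn_integral_eq_integral[symmetric, OF iab]) simp
    also have "\<dots> \<le> (\<integral>\<^sup>+r. K j (x(i := r)) \<partial>M i)"
    proof (rule nn_integral_mono_AE)
      show "AE r in M i. ennreal ((?a r - ?b r)\<^sup>2) \<le> K j (x(i := r))"
        using S(2)[of i]
      proof eventually_elim
        fix r assume r: "r \<in> S i"
        have "x(i := r) \<in> (\<Pi>\<^sub>E i\<in>insert i I. S i)"
          using x r by (auto simp: PiE_def extensional_def)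
        from osc[OF insertI2[OF j] this s]
        show "ennreal ((?a r - ?b r)\<^sup>2) \<le> K j (x(i := r))"
          by (simp only: fun_upd_twist[OF ij])
      qed
    qed
    finally show "ennreal ((F (x(j := s)) - F (x(j := s')))\<^sup>2) \<le> (\<integral>\<^sup>+r. K j (x(i := r)) \<partial>M i)"
      by (simp add: ennreal_leI)
  qed (use BF in auto)
  also have "\<dots> = (\<Sum>j\<in>I. \<integral>\<^sup>+x. K j x \<partial>PiM (insert i I) M)"
    using insert.hyps Km by (intro sum.cong refl product_nn_integral_insert[symmetric]) auto
  finally have second': "ennreal ((\<integral>x. (F x)\<^sup>2 \<partial>PiM I M) - (\<integral>x. F x \<partial>PiM I M)\<^sup>2)
      \<le> (\<Sum>j\<in>I. \<integral>\<^sup>+x. K j x \<partial>PiM (insert i I) M)" .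
  have nn: "(\<integral>x. G x - (F x)\<^sup>2 \<partial>PiM I M) \<ge> 0"
    using GF by (intro integral_nonneg_AE AE_I2) auto
  \<comment> \<open>Since \<open>ennreal\<close> truncates negative numbers to 0, only the sign of
    the first summand matters here.\<close>
  have ennreal_add: "ennreal (a + b) \<le> ennreal a + ennreal b" if "a \<ge> 0" for a b :: real
    using that by (cases "b \<ge> 0") (auto simp: ennreal_neg ennreal_leI)
  show ?case
    unfolding split sum.insert[OF insert.hyps]
    by (rule order_trans[OF ennreal_add[OF nn] add_mono[OF first second']])
qed

subsection \<open>Functions on coordinate space\<close>

lemma points_upd [simp]: "x \<in> points d \<Longrightarrow> i < d \<Longrightarrow> x(i := s) \<in> points d"
  by (auto simp: points_def PiE_def extensional_def)

lemma tendsto_componentwise_fun: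
  fixes X :: "'c \<Rightarrow> 'a \<Rightarrow> 'b::topological_space"
  shows "(X \<longlongrightarrow> l) F \<longleftrightarrow> (\<forall>i. ((\<lambda>m. X m i) \<longlongrightarrow> l i) F)"
proof -
  have "limitin (product_topology (\<lambda>i. euclidean) UNIV) X l F \<longleftrightarrow> (\<forall>i. ((\<lambda>m. X m i) \<longlongrightarrow> l i) F)"
    by (simp add: limitin_componentwise)
  then show ?thesis by (simp add: euclidean_product_topology)
qed

lemma closed_points: "closed (points d)"
proof -
  have "points d = (\<Inter>i\<in>{d..}. {x. x i = undefined})"
    by (auto simp: points_def PiE_def extensional_def)
  moreover have "closed {x::nat \<Rightarrow> real. x i = undefined}" for i
    by (intro closed_Collect_eq continuous_on_product_coordinates continuous_on_const)
  ultimately show ?thesis by (simp add: closed_INT)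
qed

text \<open>Tychonoff's theorem, with the coordinates from \<open>d\<close> on pinned to the compact
  singleton \<open>{undefined}\<close>.\<close>

lemma compact_PiE_points:
  assumes "\<And>i. i < d \<Longrightarrow> compact (S i)"
  shows "compact (\<Pi>\<^sub>E i\<in>{..<d}. S i :: real set)"
proof -
  have "(\<Pi>\<^sub>E i\<in>{..<d}. S i) = (\<Pi>\<^sub>E i\<in>UNIV. if i < d then S i else {undefined})"
    by (auto simp: PiE_def extensional_def Pi_def split: if_splits)
  moreover have "compactin (product_topology (\<lambda>i. euclidean) UNIV)
      (\<Pi>\<^sub>E i\<in>UNIV. if i < d then S i else {undefined})"
    using assms by (subst compactin_PiE) (auto simp: compactin_euclidean_iff)
  ultimately show ?thesis
    by (simp add: euclidean_product_topology)
qed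

lemma pd_has_derivative:
  "pd_exists i f x \<Longrightarrow> ((\<lambda>s. f (x(i := s))) has_real_derivative pd i f x) (at (x i))"
  unfolding pd_exists_def pd_def by (simp add: DERIV_deriv_iff_real_differentiable)

text \<open>The regularity hypothesis asserts continuity of the derivatives but not of \<rho>, u and
  p themselves. It follows from the classical argument that changes one coordinate at a time and
  applies the mean value theorem on each segment.\<close>

lemma continuous_on_points_if_pd:
  assumes ex: "\<And>i x. i < d \<Longrightarrow> x \<in> points d \<Longrightarrow> pd_exists i f x"
    and cont: "\<And>i. i < d \<Longrightarrow> continuous_on (points d) (pd i f)"
  shows "continuous_on (points d) f"
  unfolding continuous_on_sequentially
proof (intro allI ballI impI, elim conjE)
  fix X :: "nat \<Rightarrow> nat \<Rightarrow> real" and a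
  assume a: "a \<in> points d" and X: "\<forall>m. X m \<in> points d" and lim: "X \<longlonglongrightarrow> a"
  \<comment> \<open>\<open>Y k m\<close> interpolates between the limit \<open>a\<close> at
    \<open>k = 0\<close> and \<open>X m\<close> at \<open>k = d\<close>.\<close>
  define Y where "Y k m = (\<lambda>i. if i < k then X m i else a i)" for k m
  have Yp: "Y k m \<in> points d" if "k \<le> d" for k m
    using a X that by (auto simp: Y_def points_def PiE_def extensional_def)
  have limc: "(\<lambda>m. X m i) \<longlonglongrightarrow> a i" for i
    using lim by (simp add: tendsto_componentwise_fun)
  have "(\<lambda>m. f (Y k m)) \<longlonglongrightarrow> f a" if "k \<le> d" for k
    using that
  proof (induction k)
    case 0
    then show ?case by (simp add: Y_def)
  next
    case (Suc k)
    then have k: "k < d" by simp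
    have Ys: "Y (Suc k) m = (Y k m)(k := X m k)" for m
      by (auto simp: Y_def fun_eq_iff less_Suc_eq)
    have "\<exists>\<xi>. f (Y (Suc k) m) - f (Y k m) = (X m k - a k) * pd k f ((Y k m)(k := \<xi>)) \<and>
        \<bar>\<xi> - a k\<bar> \<le> \<bar>X m k - a k\<bar>" for m
    proof -
      let ?h = "\<lambda>s. f ((Y k m)(k := s))"
      have d: "(?h has_real_derivative pd k f ((Y k m)(k := s))) (at s)" for s
        using pd_has_derivative[OF ex[OF k, of "(Y k m)(k := s)"]] Yp[of k m] k by simp
      have "?h (X m k) = f (Y (Suc k) m)" "?h (a k) = f (Y k m)"
        using Ys by (simp, intro arg_cong[of _ _ f]) (auto simp: Y_def)
      moreover consider "X m k = a k" | "X m k < a k" | "X m k > a k" by linarith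
      then have "\<exists>\<xi>. ?h (X m k) - ?h (a k) = (X m k - a k) * pd k f ((Y k m)(k := \<xi>)) \<and>
        \<bar>\<xi> - a k\<bar> \<le> \<bar>X m k - a k\<bar>"
      proof cases
        case 1
        then show ?thesis by (intro exI[of _ "a k"]) simp
      next
        case 2
        from MVT2[OF this d] obtain z where "X m k < z" "z < a k"
          "?h (a k) - ?h (X m k) = (a k - X m k) * pd k f ((Y k m)(k := z))" by blast
        then show ?thesis by (intro exI[of _ z]) (auto simp: algebra_simps)
      next
        case 3
        from MVT2[OF this d] obtain z where "a k < z" "z < X m k"
          "?h (X m k) - ?h (a k) = (X m k - a k) * pd k f ((Y k m)(k := z))" by blast
        then show ?thesis by (intro exI[of _ z]) auto
      qed
      ultimately show ?thesis by simp
    qed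
    then obtain \<xi> where \<xi>: "\<And>m. f (Y (Suc k) m) - f (Y k m) = (X m k - a k) * pd k f ((Y k m)(k := \<xi> m))"
      "\<And>m. \<bar>\<xi> m - a k\<bar> \<le> \<bar>X m k - a k\<bar>" by metis
    have lim0: "(\<lambda>m. X m k - a k) \<longlonglongrightarrow> 0" using limc[of k] by (simp add: LIM_zero)
    have "(\<lambda>m. \<xi> m - a k) \<longlonglongrightarrow> 0"
      by (rule Lim_null_comparison[OF _ tendsto_rabs_zero[OF lim0]]) (use \<xi>(2) in auto)
    then have lx: "\<xi> \<longlonglongrightarrow> a k" by (simp add: LIM_zero_iff)
    have "(\<lambda>m. (Y k m)(k := \<xi> m)) \<longlonglongrightarrow> a"
      unfolding tendsto_componentwise_fun
    proof
      fix i show "(\<lambda>m. ((Y k m)(k := \<xi> m)) i) \<longlonglongrightarrow> a i"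
        using lx limc[of i] by (cases "i = k"; cases "i < k") (auto simp: Y_def)
    qed
    then have "(\<lambda>m. pd k f ((Y k m)(k := \<xi> m))) \<longlonglongrightarrow> pd k f a"
      using cont[OF k] a Yp[of k] k unfolding continuous_on_sequentially comp_def by auto
    from tendsto_mult[OF lim0 this] have "(\<lambda>m. f (Y (Suc k) m) - f (Y k m)) \<longlonglongrightarrow> 0"
      by (simp add: \<xi>(1))
    from tendsto_add[OF this Suc.IH] k show ?case by simp
  qed
  from this[of d] have "(\<lambda>m. f (Y d m)) \<longlonglongrightarrow> f a" by simp
  \<comment> \<open>From index \<open>d\<close> on, both \<open>X m\<close> and \<open>a\<close> are
    \<open>undefined\<close>.\<close>
  moreover have "Y d m = X m" for m
    using X a by (fastforce simp: Y_def points_def PiE_def extensional_def)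
  ultimately show "(f \<circ> X) \<longlonglongrightarrow> f a" by (simp add: comp_def)
qed

text \<open>\<open>PiM\<close> lives on extensional functions, whereas continuity refers to the
  product topology on all functions. The inclusion is measurable coordinatewise, and
  \<open>f\<close> is extended by zero off the closed set \<open>points d\<close>.\<close>

lemma borel_measurable_continuous_points:
  fixes f :: "(nat \<Rightarrow> real) \<Rightarrow> real"
  assumes "continuous_on (points d) f" and sets: "\<And>i. sets (M i) = sets borel"
  shows "f \<in> borel_measurable (PiM {..<d} M)"
proof -
  have s[measurable_cong]: "sets (M i) = sets borel" for i by (rule sets)
  have sp: "space (PiM {..<d} M) = points d"
    using sets_eq_imp_space_eq[OF sets] by (simp add: space_PiM points_def)
  have "(\<lambda>x. x) \<in> PiM {..<d} M \<rightarrow>\<^sub>M (borel :: (nat \<Rightarrow> real) measure)"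
  proof (rule measurable_coordinatewise_then_product)
    fix i show "(\<lambda>x. x i) \<in> borel_measurable (PiM {..<d} M)"
    proof (cases "i < d")
      case False
      then have "(\<lambda>x. x i) \<in> borel_measurable (PiM {..<d} M) \<longleftrightarrow>
          (\<lambda>x. undefined :: real) \<in> borel_measurable (PiM {..<d} M)"
        by (intro measurable_cong) (auto simp: sp points_def PiE_def extensional_def)
      then show ?thesis by simp
    qed measurable
  qed
  moreover have "(\<lambda>x. indicator (points d) x *\<^sub>R f x) \<in> borel_measurable borel"
    using assms(1) closed_points by (intro borel_measurable_continuous_on_indicator) auto
  ultimately have "(\<lambda>x. indicator (points d) x *\<^sub>R f x) \<in> borel_measurable (PiM {..<d} M)"
    by (rule measurable_compose)
  moreover have "f \<in> borel_measurable (PiM {..<d} M) \<longleftrightarrow>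
      (\<lambda>x. indicator (points d) x *\<^sub>R f x) \<in> borel_measurable (PiM {..<d} M)"
    by (intro measurable_cong) (simp add: sp)
  ultimately show ?thesis by simp
qed

text \<open>Both measures agree on rectangles, which determine a product measure. The lemma converts
  products of normalized one-dimensional measures into densities with respect to
  \<open>vol\<close>.\<close>

lemma PiM_density:
  fixes g :: "'i \<Rightarrow> 'a \<Rightarrow> ennreal"
  assumes "product_sigma_finite M" "product_sigma_finite (\<lambda>i. density (M i) (g i))"
    and fin: "finite I" and [measurable]: "\<And>i. i \<in> I \<Longrightarrow> g i \<in> borel_measurable (M i)"
  shows "PiM I (\<lambda>i. density (M i) (g i)) = density (PiM I M) (\<lambda>x. \<Prod>i\<in>I. g i (x i))"
proof -
  interpret M: product_sigma_finite M by fact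
  interpret D: product_sigma_finite "\<lambda>i. density (M i) (g i)" by fact
  have gm[measurable]: "(\<lambda>x. \<Prod>i\<in>I. g i (x i)) \<in> borel_measurable (PiM I M)"
    by (intro borel_measurable_prod_ennreal) measurable
  show ?thesis
  proof (rule D.PiM_eqI[OF fin, symmetric])
    show "sets (density (PiM I M) (\<lambda>x. \<Prod>i\<in>I. g i (x i))) = sets (PiM I (\<lambda>i. density (M i) (g i)))"
      by (simp, intro sets_PiM_cong) auto
  next
    fix A assume A: "\<And>i. i \<in> I \<Longrightarrow> A i \<in> sets (density (M i) (g i))"
    then have A'[measurable]: "A i \<in> sets (M i)" if "i \<in> I" for i using that by simp
    have PA: "Pi\<^sub>E I A \<in> sets (PiM I M)" using A' fin by (intro sets_PiM_I_finite) auto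
    have "emeasure (density (PiM I M) (\<lambda>x. \<Prod>i\<in>I. g i (x i))) (Pi\<^sub>E I A)
        = (\<integral>\<^sup>+x. (\<Prod>i\<in>I. g i (x i)) * indicator (Pi\<^sub>E I A) x \<partial>PiM I M)"
      using PA by (simp add: emeasure_density)
    also have "\<dots> = (\<integral>\<^sup>+x. (\<Prod>i\<in>I. g i (x i) * indicator (A i) (x i)) \<partial>PiM I M)"
    proof (rule nn_integral_cong)
      fix x assume "x \<in> space (PiM I M)"
      then have "indicator (Pi\<^sub>E I A) x = (\<Prod>i\<in>I. indicator (A i) (x i) :: ennreal)"
        using fin by (auto simp: indicator_def space_PiM PiE_def Pi_def prod_zero_iff split: if_splits)
      then show "(\<Prod>i\<in>I. g i (x i)) * indicator (Pi\<^sub>E I A) x = (\<Prod>i\<in>I. g i (x i) * indicator (A i) (x i))"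
        by (simp add: prod.distrib)
    qed
    also have "\<dots> = (\<Prod>i\<in>I. \<integral>\<^sup>+s. g i s * indicator (A i) s \<partial>M i)"
      using fin by (intro M.product_nn_integral_prod) measurable
    also have "\<dots> = (\<Prod>i\<in>I. emeasure (density (M i) (g i)) (A i))"
      using A' by (intro prod.cong refl) (simp add: emeasure_density)
    finally show "emeasure (density (PiM I M) (\<lambda>x. \<Prod>i\<in>I. g i (x i))) (Pi\<^sub>E I A)
        = (\<Prod>i\<in>I. emeasure (density (M i) (g i)) (A i))" .
  qed
qed

text \<open>Fubini with the distinguished coordinate integrated last; with the height as that
  coordinate, the inner integral is a slice mean.\<close>

lemma (in product_sigma_finite) product_integral_insert_rev:
  fixes f :: "_ \<Rightarrow> real"
  assumes I: "finite I" "i \<notin> I" and f: "integrable (PiM (insert i I) M) f"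
  shows "integral\<^sup>L (PiM (insert i I) M) f = (\<integral>y. (\<integral>x. f (x(i := y)) \<partial>PiM I M) \<partial>M i)"
    and "integrable (M i) (\<lambda>y. \<integral>x. f (x(i := y)) \<partial>PiM I M)"
proof -
  interpret I: finite_product_sigma_finite M I by standard fact
  interpret pair_sigma_finite "PiM I M" "M i" by unfold_locales
  have upd: "(\<lambda>(x, r). x(i := r)) \<in> PiM I M \<Otimes>\<^sub>M M i \<rightarrow>\<^sub>M PiM (insert i I) M"
    by (rule measurable_add_dim)
  have fm: "(\<lambda>(x, r). f (x(i := r))) \<in> borel_measurable (PiM I M \<Otimes>\<^sub>M M i)"
    using measurable_compose[OF upd, of f borel] f by (simp add: case_prod_unfold)
  have "(\<integral>\<^sup>+p. ennreal (norm (f ((fst p)(i := snd p)))) \<partial>(PiM I M \<Otimes>\<^sub>M M i))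
      = (\<integral>\<^sup>+x. \<integral>\<^sup>+r. ennreal (norm (f (x(i := r)))) \<partial>M i \<partial>PiM I M)"
    using fm by (subst sigma_finite_measure.nn_integral_fst[OF sigma_finite_measures, symmetric]) (auto simp: case_prod_unfold)
  also have "\<dots> = (\<integral>\<^sup>+x. ennreal (norm (f x)) \<partial>PiM (insert i I) M)"
    using f I by (subst product_nn_integral_insert) auto
  also have "\<dots> < \<infinity>" using f by (simp add: integrable_iff_bounded)
  finally have int: "integrable (PiM I M \<Otimes>\<^sub>M M i) (\<lambda>(x, r). f (x(i := r)))"
    using fm by (simp add: integrable_iff_bounded case_prod_unfold)
  have "integral\<^sup>L (PiM (insert i I) M) f = (\<integral>x. (\<integral>y. f (x(i := y)) \<partial>M i) \<partial>PiM I M)"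
    by (rule product_integral_insert[OF I f])
  also have "\<dots> = (\<integral>y. (\<integral>x. f (x(i := y)) \<partial>PiM I M) \<partial>M i)"
    using Fubini_integral[OF int] by simp
  finally show "integral\<^sup>L (PiM (insert i I) M) f = (\<integral>y. (\<integral>x. f (x(i := y)) \<partial>PiM I M) \<partial>M i)" .
  show "integrable (M i) (\<lambda>y. \<integral>x. f (x(i := y)) \<partial>PiM I M)"
    using integrable_snd[OF int] by simp
qed

text \<open>Differentiability in one direction only: the divergence theorem needs just the
  derivative of the i-th flux component along coordinate \<open>i\<close>, and of the second
  derivatives of \<rho> only the pure ones are available. The derivative is an explicit argument so
  that product and sum rules compute it.\<close>

definition dir_C1 :: "nat \<Rightarrow> nat \<Rightarrow> ((nat \<Rightarrow> real) \<Rightarrow> real) \<Rightarrow> ((nat \<Rightarrow> real) \<Rightarrow> real) \<Rightarrow> bool" where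
  "dir_C1 d i F F' \<longleftrightarrow> continuous_on (points d) F \<and> continuous_on (points d) F' \<and>
     (\<forall>x\<in>points d. ((\<lambda>s. F (x(i := s))) has_real_derivative F' x) (at (x i)))"

text \<open>The base point \<open>x\<close> is allowed to lack its coordinate \<open>i\<close>, as
  happens inside Fubini arguments; only the points of the line have to lie in
  \<open>points d\<close>.\<close>

lemma dir_C1_line:
  assumes "dir_C1 d i F F'" "\<And>s. x(i := s) \<in> points d"
  shows "((\<lambda>s. F (x(i := s))) has_real_derivative F' (x(i := s))) (at s)"
    and "continuous_on A (\<lambda>s. F' (x(i := s)))"
proof -
  have "((\<lambda>r. F ((x(i := s))(i := r))) has_real_derivative F' (x(i := s))) (at ((x(i := s)) i))"
    using assms unfolding dir_C1_def by blast
  then show "((\<lambda>s. F (x(i := s))) has_real_derivative F' (x(i := s))) (at s)" by simp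
  have "continuous_on A (\<lambda>s. x(i := s))"
  proof (rule continuous_on_coordinatewise_then_product)
    fix j show "continuous_on A (\<lambda>s. (x(i := s)) j)"
      by (cases "j = i") (auto intro: continuous_intros)
  qed
  then show "continuous_on A (\<lambda>s. F' (x(i := s)))"
    using assms unfolding dir_C1_def
    by (intro continuous_on_compose2[of "points d" F' A]) auto
qed

lemma dir_C1_const: "dir_C1 d i (\<lambda>x. c) (\<lambda>x. 0)"
  by (simp add: dir_C1_def)

lemma dir_C1_coordinate: "dir_C1 d i (\<lambda>x. x k) (\<lambda>x. if k = i then 1 else 0)"
  by (cases "k = i")
     (auto simp: dir_C1_def intro: continuous_on_subset[OF continuous_on_product_coordinates])

lemma dir_C1_diff:
  "dir_C1 d i F F' \<Longrightarrow> dir_C1 d i G G' \<Longrightarrow> dir_C1 d i (\<lambda>x. F x - G x) (\<lambda>x. F' x - G' x)"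
  by (auto simp: dir_C1_def intro: continuous_intros DERIV_diff)

lemma dir_C1_mult:
  assumes "dir_C1 d i F F'" "dir_C1 d i G G'"
  shows "dir_C1 d i (\<lambda>x. F x * G x) (\<lambda>x. F' x * G x + F x * G' x)"
  unfolding dir_C1_def
proof (intro conjI ballI)
  fix x assume x: "x \<in> points d"
  have "((\<lambda>s. F (x(i := s)) * G (x(i := s))) has_real_derivative
      F' x * G (x(i := x i)) + G' x * F (x(i := x i))) (at (x i))"
    using assms x unfolding dir_C1_def by (intro DERIV_mult) auto
  then show "((\<lambda>s. F (x(i := s)) * G (x(i := s))) has_real_derivative
      F' x * G x + F x * G' x) (at (x i))" by (simp add: mult.commute)
qed (use assms in \<open>auto simp: dir_C1_def intro!: continuous_intros\<close>)

lemma dir_C1_sum: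
  assumes "\<And>j. j \<in> J \<Longrightarrow> dir_C1 d i (F j) (F' j)"
  shows "dir_C1 d i (\<lambda>x. \<Sum>j\<in>J. F j x) (\<lambda>x. \<Sum>j\<in>J. F' j x)"
  using assms unfolding dir_C1_def
  by (auto intro!: continuous_intros DERIV_sum)

text \<open>Uniqueness of derivatives along the shifted line. It supplies the periodicity of the
  diffusive flux components, which contain \<open>pd i (\<rho> t)\<close>.\<close>

lemma dir_C1_periodic:
  assumes "dir_C1 d i F F'" "i < d" and per: "\<And>x. x \<in> points d \<Longrightarrow> F (x(i := x i + L)) = F x"
    and x: "x \<in> points d"
  shows "F' (x(i := x i + L)) = F' x"
proof -
  have xs: "x(i := s) \<in> points d" for s using x assms(2) by simp
  note l = dir_C1_line(1)[OF assms(1) xs]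
  have "((\<lambda>s. F (x(i := s + L))) has_real_derivative F' (x(i := x i + L))) (at (x i))"
    using l[of "x i + L"] by (subst (asm) DERIV_shift) 
  moreover have "F (x(i := s + L)) = F (x(i := s))" for s
    using per[OF xs[of s]] by simp
  ultimately have "((\<lambda>s. F (x(i := s))) has_real_derivative F' (x(i := x i + L))) (at (x i))" by simp
  from DERIV_unique[OF this l[of "x i"]] show ?thesis by simp
qed

subsection \<open>Boxes and slices of the strip\<close>

lemma integrable_indicator_continuous:
  fixes g :: "real \<Rightarrow> real"
  assumes "continuous_on UNIV g"
  shows "integrable lborel (\<lambda>r. indicator {a..b} r * g r)"
  using borel_integrable_compact[of "{a..b}" g] assms continuous_on_subset by auto

lemma FTC_indicator:
  fixes g :: "real \<Rightarrow> real"
  assumes "a \<le> b" "\<And>r. (g has_real_derivative g' r) (at r)" "continuous_on UNIV g'"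
  shows "(\<integral>r. indicator {a..b} r * g' r \<partial>lborel) = g b - g a"
  using integral_FTC_Icc_real[of a b g g'] assms
  by (simp add: mult.commute continuous_on_eq_continuous_at)

text \<open>Cauchy--Schwarz for the increment, by expanding the square of \<open>g'\<close> minus its mean.\<close>

lemma increment_sq_le:
  fixes g :: "real \<Rightarrow> real"
  assumes d: "\<And>r. (g has_real_derivative g' r) (at r)" and c: "continuous_on UNIV g'"
    and s: "s \<in> {0..L}" "s' \<in> {0..L}"
  shows "(g s - g s')\<^sup>2 \<le> L * (\<integral>r. indicator {0..L} r * (g' r)\<^sup>2 \<partial>lborel)"
proof -
  have c2: "continuous_on UNIV (\<lambda>r. (g' r)\<^sup>2)" using c by (intro continuous_intros)
  have main: "(g b - g a)\<^sup>2 \<le> L * (\<integral>r. indicator {0..L} r * (g' r)\<^sup>2 \<partial>lborel)"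
    if ab: "a < b" "a \<in> {0..L}" "b \<in> {0..L}" for a b
  proof -
    define m where "m = (g b - g a) / (b - a)"
    let ?I = "indicator {a..b} :: real \<Rightarrow> real"
    have i1: "integrable lborel (\<lambda>r. ?I r * g' r)" and i2: "integrable lborel (\<lambda>r. ?I r * (g' r)\<^sup>2)"
      and i3: "integrable lborel (\<lambda>r. ?I r * 1)"
      by (rule integrable_indicator_continuous[OF c], rule integrable_indicator_continuous[OF c2],
          rule integrable_indicator_continuous) auto
    have "0 \<le> (\<integral>r. ?I r * (g' r - m)\<^sup>2 \<partial>lborel)" by (rule integral_nonneg_AE) simp
    also have "(\<integral>r. ?I r * (g' r - m)\<^sup>2 \<partial>lborel)
        = (\<integral>r. ?I r * (g' r)\<^sup>2 - 2 * m * (?I r * g' r) + m\<^sup>2 * (?I r * 1) \<partial>lborel)"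
      by (rule Bochner_Integration.integral_cong) (auto simp: power2_diff algebra_simps)
    also have "\<dots> = (\<integral>r. ?I r * (g' r)\<^sup>2 \<partial>lborel) - 2 * m * (\<integral>r. ?I r * g' r \<partial>lborel)
        + m\<^sup>2 * (\<integral>r. ?I r * 1 \<partial>lborel)"
      using i1 i2 i3 by (subst Bochner_Integration.integral_add; simp)
    also have "(\<integral>r. ?I r * g' r \<partial>lborel) = g b - g a"
      by (rule FTC_indicator) (use ab d c in auto)
    also have "(\<integral>r. ?I r * 1 \<partial>lborel) = b - a" using ab by simp
    also have "g b - g a = m * (b - a)" using ab by (simp add: m_def)
    finally have "m\<^sup>2 * (b - a) \<le> (\<integral>r. ?I r * (g' r)\<^sup>2 \<partial>lborel)"
      by (simp add: power2_eq_square algebra_simps)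
    also have "\<dots> \<le> (\<integral>r. indicator {0..L} r * (g' r)\<^sup>2 \<partial>lborel)"
      by (rule integral_mono[OF i2 integrable_indicator_continuous[OF c2]])
         (use ab in \<open>auto simp: indicator_def\<close>)
    finally have le: "m\<^sup>2 * (b - a) \<le> (\<integral>r. indicator {0..L} r * (g' r)\<^sup>2 \<partial>lborel)" .
    have "(g b - g a)\<^sup>2 = (b - a) * (m\<^sup>2 * (b - a))"
      using ab by (simp add: m_def power2_eq_square)
    also have "\<dots> \<le> L * (\<integral>r. indicator {0..L} r * (g' r)\<^sup>2 \<partial>lborel)"
      using ab le by (intro mult_mono) auto
    finally show ?thesis .
  qed
  have "0 \<le> L * (\<integral>r. indicator {0..L} r * (g' r)\<^sup>2 \<partial>lborel)"
    using s by (intro mult_nonneg_nonneg integral_nonneg_AE) auto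
  then show ?thesis
    using main[of s s'] main[of s' s] s
    by (cases s s' rule: linorder_cases) (auto simp: power2_commute)
qed

section \<open>Normalized measures on the strip with \<open>n\<close> periodic coordinates and
  height coordinate \<open>n\<close>\<close>

locale strip_domain =
  fixes n :: nat and L :: real
  assumes L_pos: "L > 0"
begin

text \<open>Dividing Lebesgue measure by \<open>L\<close> in each horizontal factor absorbs the
  prefactor of \<open>strip_avg\<close> and makes the cross-section measure \<open>Q\<close> a
  probability measure, to which the variance inequality applies.\<close>

definition cell :: "real measure" where
  "cell = density lborel (\<lambda>s. ennreal (indicator {0..L} s / L))"

definition factor :: "nat \<Rightarrow> real measure" where
  "factor i = (if i < n then cell else lborel)"

definition P :: "(nat \<Rightarrow> real) measure" where "P = PiM {..<Suc n} factor"

definition Q :: "(nat \<Rightarrow> real) measure" where "Q = PiM {..<n} (\<lambda>_. cell)"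

lemma sets_cell [measurable_cong, simp]: "sets cell = sets borel"
  and space_cell [simp]: "space cell = UNIV"
  by (auto simp: cell_def)

lemma sets_factor [measurable_cong, simp]: "sets (factor i) = sets borel"
  and space_factor [simp]: "space (factor i) = UNIV"
  by (auto simp: factor_def)

lemma space_P [simp]: "space P = points (Suc n)"
  by (simp add: P_def space_PiM points_def)

lemma space_Q [simp]: "space Q = points n"
  by (simp add: Q_def space_PiM points_def)

lemma prob_space_cell: "prob_space cell"
proof
  have "emeasure cell (space cell) = (\<integral>\<^sup>+s. ennreal (1 / L) * indicator {0..L} s \<partial>lborel)"
    unfolding cell_def using L_pos
    by (subst emeasure_density) (auto intro!: nn_integral_cong simp: indicator_def)
  also have "\<dots> = 1" using L_pos by (simp add: nn_integral_cmult ennreal_mult[symmetric])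
  finally show "emeasure cell (space cell) = 1" .
qed

sublocale cell: prob_space cell by (rule prob_space_cell)

sublocale F: product_sigma_finite factor
  by (intro product_sigma_finite.intro)
     (auto simp: factor_def intro: prob_space_imp_sigma_finite[OF prob_space_cell] lborel.sigma_finite_measure_axioms)

sublocale C: product_prob_space "\<lambda>_::nat. cell"
  by unfold_locales

sublocale Q: prob_space Q
  unfolding Q_def by (intro prob_space_PiM prob_space_cell)

lemma AE_cell: "AE s in cell. s \<in> {0..L}"
  unfolding cell_def using L_pos by (subst AE_density) (auto simp: indicator_def)

lemma AE_Q: "AE y in Q. y \<in> (\<Pi>\<^sub>E i\<in>{..<n}. {0..L})"
proof -
  have "AE y in Q. \<forall>j\<in>{..<n}. y j \<in> {0..L}"
    unfolding Q_def by (intro AE_finite_allI AE_PiM_component AE_cell prob_space_cell) auto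
  with AE_space show ?thesis
    by eventually_elim (auto simp: points_def PiE_def)
qed

lemma integral_cell:
  fixes g :: "real \<Rightarrow> real"
  assumes "g \<in> borel_measurable borel"
  shows "(\<integral>s. g s \<partial>cell) = (1 / L) * (\<integral>s. indicator {0..L} s * g s \<partial>lborel)"
  unfolding cell_def using assms L_pos
  by (subst integral_density) (auto simp: divide_simps)

lemma P_eq_density:
  "P = density (vol (Suc n)) (\<lambda>x. ennreal (indicator (strip (Suc n) L) x / L ^ n))"
proof -
  define g :: "nat \<Rightarrow> real \<Rightarrow> ennreal" where
    "g i s = ennreal (if i < n then indicator {0..L} s / L else 1)" for i s
  have f: "factor = (\<lambda>i. density lborel (g i))"
    by (intro ext) (simp add: factor_def cell_def g_def[abs_def] density_1)
  have "P = density (vol (Suc n)) (\<lambda>x. \<Prod>i<Suc n. g i (x i))"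
    unfolding P_def f
  proof (rule PiM_density)
    show "product_sigma_finite (\<lambda>i::nat. lborel :: real measure)" by unfold_locales
    show "product_sigma_finite (\<lambda>i. density lborel (g i))"
      using F.product_sigma_finite_axioms unfolding f .
    show "g i \<in> borel_measurable lborel" for i
      unfolding g_def by (cases "i < n") auto
  qed auto
  also have "\<dots> = density (vol (Suc n)) (\<lambda>x. ennreal (indicator (strip (Suc n) L) x / L ^ n))"
  proof (rule density_cong)
    show "AE x in vol (Suc n). (\<Prod>i<Suc n. g i (x i)) = ennreal (indicator (strip (Suc n) L) x / L ^ n)"
    proof (rule AE_I2)
      fix x assume "x \<in> space (vol (Suc n))"
      then have x: "x \<in> points (Suc n)" by (simp add: space_PiM points_def)
      have "(\<Prod>i<Suc n. g i (x i)) = (\<Prod>i<n. ennreal (indicator {0..L} (x i) / L))"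
        by (simp add: g_def)
      also have "\<dots> = ennreal (\<Prod>i<n. indicator {0..L} (x i) / L)"
        using L_pos by (intro prod_ennreal) auto
      also have "(\<Prod>i<n. indicator {0..L} (x i) / L) = indicator (strip (Suc n) L) x / L ^ n"
      proof (cases "x \<in> strip (Suc n) L")
        case True
        then have "x i \<in> {0..L}" if "i < n" for i
          using that unfolding strip_def PiE_def Pi_def by (auto dest!: spec[of _ i])
        then show ?thesis using True L_pos by (simp add: power_one_over)
      next
        case False
        then obtain i where "i < n" "x i \<notin> {0..L}"
          using x by (auto simp: strip_def points_def PiE_def Pi_def split: if_splits)
        then have "(\<Prod>i<n. indicator {0..L} (x i) / L) = 0"
          by (intro prod_zero bexI[of _ i]) auto
        then show ?thesis using False by simp
      qed
      finally show "(\<Prod>i<Suc n. g i (x i)) = ennreal (indicator (strip (Suc n) L) x / L ^ n)" .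
    qed
  qed (auto simp: g_def strip_def)
  finally show ?thesis .
qed

lemma measurable_P_iff: "f \<in> borel_measurable P \<longleftrightarrow> f \<in> borel_measurable (vol (Suc n))"
  by (simp add: P_eq_density)

lemma strip_sets [measurable]: "strip (Suc n) L \<in> sets (vol (Suc n))"
  unfolding strip_def by (intro sets_PiM_I_finite) auto

text \<open>Integrability is not assumed: if it fails, both integrals take the default value
  0.\<close>

lemma strip_avg_eq:
  assumes "f \<in> borel_measurable P"
  shows "strip_avg (Suc n) L f = (\<integral>x. f x \<partial>P)"
proof -
  have "(\<integral>x. f x \<partial>P) = (\<integral>x. (1 / L ^ n) * (indicator (strip (Suc n) L) x *\<^sub>R f x) \<partial>vol (Suc n))"
    unfolding P_eq_density using assms L_pos
    by (subst integral_density) (auto simp: measurable_P_iff)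
  also have "\<dots> = strip_avg (Suc n) L f"
    unfolding strip_avg_def set_lebesgue_integral_def by (subst integral_mult_right_zero) simp
  finally show ?thesis ..
qed

lemma strip_integrable_iff:
  assumes "f \<in> borel_measurable P"
  shows "strip_integrable (Suc n) L f \<longleftrightarrow> integrable P f"
proof -
  have "integrable P f \<longleftrightarrow> integrable (vol (Suc n)) (\<lambda>x. (1 / L ^ n) * (indicator (strip (Suc n) L) x *\<^sub>R f x))"
    unfolding P_eq_density using assms L_pos
    by (subst integrable_density) (auto simp: measurable_P_iff)
  also have "\<dots> \<longleftrightarrow> strip_integrable (Suc n) L f"
    unfolding strip_integrable_def set_integrable_def using L_pos
    by (subst integrable_mult_left_iff) auto
  finally show ?thesis ..
qed

lemma continuous_measurable_P: "continuous_on (points (Suc n)) f \<Longrightarrow> f \<in> borel_measurable P"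
  for f :: "(nat \<Rightarrow> real) \<Rightarrow> real"
  unfolding P_def by (rule borel_measurable_continuous_points) auto

lemma continuous_measurable_Q: "continuous_on (points n) f \<Longrightarrow> f \<in> borel_measurable Q"
  for f :: "(nat \<Rightarrow> real) \<Rightarrow> real"
  unfolding Q_def by (rule borel_measurable_continuous_points) auto

lemma integrable_Q:
  fixes f :: "(nat \<Rightarrow> real) \<Rightarrow> real"
  assumes "continuous_on (points n) f"
  shows "integrable Q f"
proof -
  \<comment> \<open>The function may be unbounded on \<open>points n\<close>, but it is bounded on
    this compact cube, which has full \<open>Q\<close>-measure.\<close>
  let ?K = "\<Pi>\<^sub>E i\<in>{..<n}. {0..L}"
  have "?K \<subseteq> points n" by (auto simp: points_def PiE_def)
  then have "compact (f ` ?K)"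
    using assms by (intro compact_continuous_image compact_PiE_points continuous_on_subset[OF assms]) auto
  then have "bounded (f ` ?K)" by (rule compact_imp_bounded)
  then obtain B where B: "\<forall>y\<in>?K. norm (f y) \<le> B" by (auto simp only: bounded_iff ball_simps)
  from AE_Q have "AE y in Q. norm (f y) \<le> B" by eventually_elim (use B in auto)
  then show ?thesis
    using continuous_measurable_Q[OF assms] by (rule Q.integrable_const_bound)
qed

lemma integrable_P_box:
  fixes f :: "(nat \<Rightarrow> real) \<Rightarrow> real"
  assumes "continuous_on (points (Suc n)) f"
  shows "integrable P (\<lambda>x. indicator {a..b} (x n) * f x)"
proof -
  \<comment> \<open>The density of \<open>P\<close> vanishes off the strip, so the height cutoff
    confines the integrand to this compact set of finite volume.\<close>
  let ?K = "\<Pi>\<^sub>E i\<in>{..<Suc n}. if i < n then {0..L} else {a..b}"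
  have "?K \<subseteq> points (Suc n)" by (auto simp: points_def PiE_def)
  then have "compact (f ` ?K)"
    using assms by (intro compact_continuous_image compact_PiE_points continuous_on_subset[OF assms]) auto
  then have "bounded (f ` ?K)" by (rule compact_imp_bounded)
  then obtain B where B: "\<forall>y\<in>?K. norm (f y) \<le> B" by (auto simp only: bounded_iff ball_simps)
  have fm: "f \<in> borel_measurable (vol (Suc n))"
    using continuous_measurable_P[OF assms] by (simp add: measurable_P_iff)
  interpret V: product_sigma_finite "\<lambda>i::nat. lborel :: real measure" by unfold_locales
  have "emeasure (vol (Suc n)) ?K = (\<Prod>i<Suc n. emeasure lborel (if i < n then {0..L} else {a..b}))"
    by (intro V.emeasure_PiM) auto
  also have "\<dots> = (\<Prod>i<Suc n. ennreal (measure lborel (if i < n then {0..L} else {a..b})))"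
    by (intro prod.cong refl emeasure_eq_ennreal_measure) (auto simp: emeasure_lborel_Icc_eq)
  also have "\<dots> < \<infinity>" by (subst prod_ennreal) auto
  finally have fin: "emeasure (vol (Suc n)) ?K < \<infinity>" .
  have "integrable (vol (Suc n)) (\<lambda>x. (1 / L ^ n) * (indicator ?K x *\<^sub>R f x))"
    using fin fm B
    by (intro integrable_mult_right integrableI_bounded_set_indicator[of _ _ _ B] sets_PiM_I_finite) auto
  also have "?this \<longleftrightarrow> integrable (vol (Suc n))
      (\<lambda>x. (indicator (strip (Suc n) L) x / L ^ n) *\<^sub>R (indicator {a..b} (x n) * f x))"
  proof (rule Bochner_Integration.integrable_cong[OF refl])
    fix x assume "x \<in> space (vol (Suc n))"
    then have "indicator ?K x = (indicator (strip (Suc n) L) x * indicator {a..b} (x n) :: real)"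
      by (auto simp: indicator_def strip_def PiE_def Pi_def space_PiM less_Suc_eq split: if_splits)
    then show "(1 / L ^ n) * (indicator ?K x *\<^sub>R f x)
        = (indicator (strip (Suc n) L) x / L ^ n) *\<^sub>R (indicator {a..b} (x n) * f x)" by simp
  qed
  also have "\<dots> \<longleftrightarrow> integrable P (\<lambda>x. indicator {a..b} (x n) * f x)"
    unfolding P_eq_density using fm L_pos
    by (subst integrable_density) auto
  finally show ?thesis .
qed

text \<open>The height cutoff makes every continuous integrand integrable, so sums may be split term
  by term on a box even where the single terms have no integral over the whole strip.\<close>

definition box :: "real \<Rightarrow> real \<Rightarrow> ((nat \<Rightarrow> real) \<Rightarrow> real) \<Rightarrow> real" where
  "box a b f = (\<integral>x. indicator {a..b} (x n) * f x \<partial>P)"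

definition slice :: "((nat \<Rightarrow> real) \<Rightarrow> real) \<Rightarrow> real \<Rightarrow> real" where
  "slice f z = (\<integral>y. f (y(n := z)) \<partial>Q)"

lemma points_Suc_upd: "y \<in> points n \<Longrightarrow> y(n := z) \<in> points (Suc n)"
  by (auto simp: points_def PiE_def extensional_def)

lemma continuous_on_slice:
  fixes f :: "(nat \<Rightarrow> real) \<Rightarrow> real"
  assumes "continuous_on (points (Suc n)) f"
  shows "continuous_on (points n) (\<lambda>y. f (y(n := z)))"
proof (rule continuous_on_compose2[OF assms])
  show "continuous_on (points n) (\<lambda>y. y(n := z))"
  proof (rule continuous_on_coordinatewise_then_product)
    fix j show "continuous_on (points n) (\<lambda>y. (y(n := z)) j)"
      by (cases "j = n") (auto intro: continuous_intros continuous_on_product_coordinates continuous_on_subset)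
  qed
qed (auto intro: points_Suc_upd)

text \<open>The link to the hypotheses on boundary terms, which are phrased with
  \<open>slice_avg\<close>; the product of the cell densities is the normalized indicator of the
  cube.\<close>

lemma slice_avg_eq:
  assumes "continuous_on (points (Suc n)) f"
  shows "slice_avg (Suc n) L f z = slice f z"
proof -
  define g :: "nat \<Rightarrow> real \<Rightarrow> ennreal" where "g i s = ennreal (indicator {0..L} s / L)" for i s
  have fm: "(\<lambda>y. f (y(n := z))) \<in> borel_measurable (vol n)"
    by (rule borel_measurable_continuous_points[OF continuous_on_slice[OF assms]]) simp
  have Kc: "(\<Pi>\<^sub>E i\<in>{..<n}. {0..L}) \<in> sets (vol n)" by (intro sets_PiM_I_finite) auto
  have "Q = density (vol n) (\<lambda>x. \<Prod>i<n. g i (x i))"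
    unfolding Q_def cell_def g_def
  proof (rule PiM_density)
    show "product_sigma_finite (\<lambda>i::nat. lborel :: real measure)" by unfold_locales
    show "product_sigma_finite (\<lambda>i::nat. density lborel (\<lambda>s. ennreal (indicator {0..L} s / L)))"
      using C.product_sigma_finite_axioms unfolding cell_def .
  qed auto
  also have "\<dots> = density (vol n) (\<lambda>x. ennreal (indicator (\<Pi>\<^sub>E i\<in>{..<n}. {0..L}) x / L ^ n))"
  proof (rule density_cong)
    show "AE x in vol n. (\<Prod>i<n. g i (x i)) = ennreal (indicator (\<Pi>\<^sub>E i\<in>{..<n}. {0..L}) x / L ^ n)"
    proof (rule AE_I2)
      fix x assume "x \<in> space (vol n)"
      then have x: "x \<in> points n" by (simp add: space_PiM points_def)
      have "(\<Prod>i<n. g i (x i)) = ennreal (\<Prod>i<n. indicator {0..L} (x i) / L)"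
        unfolding g_def using L_pos by (intro prod_ennreal) auto
      also have "(\<Prod>i<n. indicator {0..L} (x i) / L) = indicator (\<Pi>\<^sub>E i\<in>{..<n}. {0..L}) x / L ^ n"
      proof (cases "x \<in> (\<Pi>\<^sub>E i\<in>{..<n}. {0..L})")
        case True
        then have "x i \<in> {0..L}" if "i < n" for i
          using that unfolding PiE_def Pi_def by (auto dest!: spec[of _ i])
        then show ?thesis using True L_pos by (simp add: power_one_over)
      next
        case False
        then obtain i where "i < n" "x i \<notin> {0..L}"
          using x by (auto simp: points_def PiE_def Pi_def split: if_splits)
        then have "(\<Prod>i<n. indicator {0..L} (x i) / L) = 0"
          by (intro prod_zero bexI[of _ i]) auto
        then show ?thesis using False by simp
      qed
      finally show "(\<Prod>i<n. g i (x i)) = ennreal (indicator (\<Pi>\<^sub>E i\<in>{..<n}. {0..L}) x / L ^ n)" .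
    qed
  qed (use Kc in \<open>auto simp: g_def\<close>)
  finally have Q: "Q = density (vol n) (\<lambda>x. ennreal (indicator (\<Pi>\<^sub>E i\<in>{..<n}. {0..L}) x / L ^ n))" .
  have "slice f z = (\<integral>y. (1 / L ^ n) * (indicator (\<Pi>\<^sub>E i\<in>{..<n}. {0..L}) y *\<^sub>R f (y(n := z))) \<partial>vol n)"
    unfolding slice_def Q using fm L_pos Kc
    by (subst integral_density) auto
  also have "\<dots> = slice_avg (Suc n) L f z"
    unfolding slice_avg_def set_lebesgue_integral_def by (subst integral_mult_right_zero) simp
  finally show ?thesis ..
qed

lemma PiM_factor_Q: "PiM {..<n} factor = Q"
  unfolding Q_def by (intro PiM_cong) (auto simp: factor_def)

text \<open>With the height integrated last, an estimate valid on every slice integrates to one on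
  the box.\<close>

lemma box_eq_slices:
  assumes "continuous_on (points (Suc n)) f"
  shows "box a b f = (\<integral>z. indicator {a..b} z * slice f z \<partial>lborel)"
    and "integrable lborel (\<lambda>z. indicator {a..b} z * slice f z)"
proof -
  have int: "integrable (PiM (insert n {..<n}) factor) (\<lambda>x. indicator {a..b} (x n) * f x)"
    using integrable_P_box[OF assms] by (simp add: P_def lessThan_Suc)
  note r = F.product_integral_insert_rev[OF _ _ int]
  show "box a b f = (\<integral>z. indicator {a..b} z * slice f z \<partial>lborel)"
    using r(1) by (simp add: box_def slice_def PiM_factor_Q P_def lessThan_Suc factor_def)
  show "integrable lborel (\<lambda>z. indicator {a..b} z * slice f z)"
    using r(2) by (simp add: slice_def PiM_factor_Q factor_def)
qed

lemma box_vertical_derivative: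
  assumes C1: "dir_C1 (Suc n) n F F'" and "a \<le> b"
  shows "box a b F' = slice F b - slice F a"
proof -
  have c: "continuous_on (points (Suc n)) F" "continuous_on (points (Suc n)) F'"
    using C1 by (auto simp: dir_C1_def)
  have int: "integrable (PiM (insert n {..<n}) factor) (\<lambda>x. indicator {a..b} (x n) * F' x)"
    using integrable_P_box[OF c(2)] by (simp add: P_def lessThan_Suc)
  have "box a b F' = (\<integral>y. (\<integral>z. indicator {a..b} z * F' (y(n := z)) \<partial>lborel) \<partial>Q)"
    using F.product_integral_insert[OF _ _ int]
    by (simp add: box_def PiM_factor_Q P_def lessThan_Suc factor_def)
  also have "\<dots> = (\<integral>y. F (y(n := b)) - F (y(n := a)) \<partial>Q)"
  proof (rule Bochner_Integration.integral_cong[OF refl])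
    fix y assume "y \<in> space Q"
    then have "\<And>s. y(n := s) \<in> points (Suc n)" by (simp add: points_Suc_upd)
    note l = dir_C1_line[OF C1 this]
    show "(\<integral>z. indicator {a..b} z * F' (y(n := z)) \<partial>lborel) = F (y(n := b)) - F (y(n := a))"
      by (rule FTC_indicator[OF \<open>a \<le> b\<close> l])
  qed
  also have "\<dots> = slice F b - slice F a"
    unfolding slice_def
    by (intro Bochner_Integration.integral_diff integrable_Q continuous_on_slice c)
  finally show ?thesis .
qed

text \<open>The inner integral runs over exactly one period, so the fundamental theorem gives equal
  boundary values.\<close>

lemma box_horizontal_derivative:
  assumes C1: "dir_C1 (Suc n) i F F'" and i: "i < n"
    and per: "\<And>x. x \<in> points (Suc n) \<Longrightarrow> F (x(i := x i + L)) = F x"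
  shows "box a b F' = 0"
proof -
  define I where "I = {..<Suc n} - {i}"
  have I: "insert i I = {..<Suc n}" "i \<notin> I" "finite I" using i by (auto simp: I_def)
  have c: "continuous_on (points (Suc n)) F'" using C1 by (auto simp: dir_C1_def)
  have int: "integrable (PiM (insert i I) factor) (\<lambda>x. indicator {a..b} (x n) * F' x)"
    using integrable_P_box[OF c] by (simp add: P_def I)
  have "box a b F' = (\<integral>x. (\<integral>s. indicator {a..b} (x n) * F' (x(i := s)) \<partial>cell) \<partial>PiM I factor)"
    using F.product_integral_insert[OF I(3,2) int] i
    by (simp add: box_def P_def I factor_def)
  also have "\<dots> = (\<integral>x. 0 \<partial>PiM I factor)"
  proof (rule Bochner_Integration.integral_cong[OF refl])
    fix x assume "x \<in> space (PiM I factor)"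
    then have xs: "\<And>s. x(i := s) \<in> points (Suc n)"
      using i by (auto simp: space_PiM points_def PiE_def extensional_def I_def)
    note l = dir_C1_line[OF C1 xs]
    have per0: "F (x(i := L)) = F (x(i := 0))" using per[OF xs[of 0]] by simp
    have "(\<integral>s. F' (x(i := s)) \<partial>cell) = (1 / L) * (\<integral>s. indicator {0..L} s * F' (x(i := s)) \<partial>lborel)"
      by (intro integral_cell borel_measurable_continuous_onI l)
    also have "(\<integral>s. indicator {0..L} s * F' (x(i := s)) \<partial>lborel) = F (x(i := L)) - F (x(i := 0))"
      by (rule FTC_indicator[OF _ l]) (use L_pos in simp)
    finally have "(\<integral>s. F' (x(i := s)) \<partial>cell) = 0" by (simp only: per0 diff_self mult_zero_right)
    then show "(\<integral>s. indicator {a..b} (x n) * F' (x(i := s)) \<partial>cell) = 0"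
      by (simp only: integral_mult_right_zero mult_zero_right)
  qed
  finally show ?thesis by simp
qed

text \<open>The variance is bounded by summed oscillations along coordinate lines, and each
  oscillation by Cauchy-Schwarz on an edge of length \<open>L\<close>. No factor depending on
  \<open>n\<close> arises.\<close>

lemma poincare_cube:
  assumes C1: "\<And>j. j < n \<Longrightarrow> dir_C1 n j h (h' j)" and cont: "continuous_on (points n) h"
    and B: "\<And>y. y \<in> points n \<Longrightarrow> \<bar>h y\<bar> \<le> B"
  shows "(\<integral>y. (h y)\<^sup>2 \<partial>Q) - (\<integral>y. h y \<partial>Q)\<^sup>2 \<le> L\<^sup>2 * (\<Sum>j<n. \<integral>y. (h' j y)\<^sup>2 \<partial>Q)"
proof -
  define \<phi> where "\<phi> j y = ennreal ((h' j y)\<^sup>2)" for j y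
  \<comment> \<open>This is \<open>L\<^sup>2\<close> times the mean of the squared derivative along
    the line through \<open>y\<close> in direction \<open>j\<close>.\<close>
  define K where "K j y = ennreal (L\<^sup>2) * (\<integral>\<^sup>+r. \<phi> j (y(j := r)) \<partial>cell)" for j y
  have hc: "continuous_on (points n) (\<lambda>y. (h' j y)\<^sup>2)" if "j < n" for j
    using C1[OF that] by (intro continuous_intros) (auto simp: dir_C1_def)
  have \<phi>m: "\<phi> j \<in> borel_measurable Q" if "j < n" for j
    unfolding \<phi>_def using continuous_measurable_Q[OF hc[OF that]] by measurable
  have ins: "insert j ({..<n} - {j}) = {..<n}" if "j < n" for j using that by auto
  have Km: "K j \<in> borel_measurable Q" if "j < n" for j
  proof -
    have "(\<lambda>(y, r). y(j := r)) \<in> Q \<Otimes>\<^sub>M cell \<rightarrow>\<^sub>M PiM {..<n} (\<lambda>_. cell)"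
      unfolding Q_def using that
      by (auto intro!: measurable_fun_upd[where J="{..<n}"] simp: case_prod_unfold)
    from measurable_compose[OF this, of "\<phi> j" borel] \<phi>m[OF that]
    have "(\<lambda>(y, r). \<phi> j (y(j := r))) \<in> borel_measurable (Q \<Otimes>\<^sub>M cell)"
      by (simp add: Q_def case_prod_unfold)
    then show ?thesis unfolding K_def by measurable
  qed
  \<comment> \<open>\<open>K j\<close> does not depend on coordinate \<open>j\<close>, so
    integrating that coordinate against a probability measure leaves it unchanged; what remains is
    Fubini.\<close>
  have intK: "(\<integral>\<^sup>+y. K j y \<partial>Q) = ennreal (L\<^sup>2) * (\<integral>\<^sup>+y. \<phi> j y \<partial>Q)" if j: "j < n" for j
  proof -
    let ?I = "{..<n} - {j}"
    have Qi: "Q = PiM (insert j ?I) (\<lambda>_. cell)" using ins[OF j] by (simp add: Q_def)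
    have m: "K j \<in> borel_measurable (PiM (insert j ?I) (\<lambda>_. cell))"
      "\<phi> j \<in> borel_measurable (PiM (insert j ?I) (\<lambda>_. cell))"
      using Km[OF j] \<phi>m[OF j] by (simp_all only: Qi)
    have "(\<integral>\<^sup>+y. K j y \<partial>Q) = (\<integral>\<^sup>+x. (\<integral>\<^sup>+s. K j (x(j := s)) \<partial>cell) \<partial>PiM ?I (\<lambda>_. cell))"
      unfolding Qi using m by (intro C.product_nn_integral_insert) auto
    also have "\<dots> = (\<integral>\<^sup>+x. ennreal (L\<^sup>2) * (\<integral>\<^sup>+r. \<phi> j (x(j := r)) \<partial>cell) \<partial>PiM ?I (\<lambda>_. cell))"
      unfolding K_def by (simp add: cell.emeasure_space_1 del: space_cell)
    also have "\<dots> = ennreal (L\<^sup>2) * (\<integral>\<^sup>+x. (\<integral>\<^sup>+r. \<phi> j (x(j := r)) \<partial>cell) \<partial>PiM ?I (\<lambda>_. cell))"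
    proof (rule nn_integral_cmult)
      have "(\<lambda>(x, r). x(j := r)) \<in> PiM ?I (\<lambda>_. cell) \<Otimes>\<^sub>M cell \<rightarrow>\<^sub>M PiM (insert j ?I) (\<lambda>_. cell)"
        by (rule measurable_add_dim)
      from measurable_compose[OF this m(2)]
      have "(\<lambda>(x, r). \<phi> j (x(j := r))) \<in> borel_measurable (PiM ?I (\<lambda>_. cell) \<Otimes>\<^sub>M cell)"
        by (simp add: case_prod_unfold)
      then show "(\<lambda>x. \<integral>\<^sup>+r. \<phi> j (x(j := r)) \<partial>cell) \<in> borel_measurable (PiM ?I (\<lambda>_. cell))"
        by measurable
    qed
    also have "(\<integral>\<^sup>+x. (\<integral>\<^sup>+r. \<phi> j (x(j := r)) \<partial>cell) \<partial>PiM ?I (\<lambda>_. cell)) = (\<integral>\<^sup>+y. \<phi> j y \<partial>Q)"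
      unfolding Qi using m by (intro C.product_nn_integral_insert[symmetric]) auto
    finally show ?thesis .
  qed
  have "ennreal ((\<integral>y. (h y)\<^sup>2 \<partial>Q) - (\<integral>y. h y \<partial>Q)\<^sup>2) \<le> (\<Sum>j<n. \<integral>\<^sup>+y. K j y \<partial>Q)"
    unfolding Q_def
  proof (rule variance_le_sum_oscillation[where B = B and S = "\<lambda>_. {0..L}"])
    fix j x s s'
    assume j: "j \<in> {..<n}" and x: "x \<in> (\<Pi>\<^sub>E i\<in>{..<n}. {0..L})" and s: "s \<in> {0..L}" "s' \<in> {0..L}"
    have xs: "\<And>r. x(j := r) \<in> points n" using x j by (auto simp: points_def PiE_def extensional_def)
    have jn: "j < n" using j by simp
    note l = dir_C1_line[OF C1[OF jn] xs]
    have c2: "continuous_on UNIV (\<lambda>r. (h' j (x(j := r)))\<^sup>2)" using l(2) by (intro continuous_intros)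
    have m2: "(\<lambda>r. (h' j (x(j := r)))\<^sup>2) \<in> borel_measurable borel"
      using c2 by (intro borel_measurable_continuous_onI)
    have i2: "integrable cell (\<lambda>r. (h' j (x(j := r)))\<^sup>2)"
      unfolding cell_def using integrable_indicator_continuous[OF c2, of 0 L] L_pos m2
      by (subst integrable_density) auto
    have "(h (x(j := s)) - h (x(j := s')))\<^sup>2 \<le> L * (\<integral>r. indicator {0..L} r * (h' j (x(j := r)))\<^sup>2 \<partial>lborel)"
      by (rule increment_sq_le[OF l s])
    \<comment> \<open>The second factor \<open>L\<close> comes from the normalization of
      \<open>cell\<close>.\<close>
    also have "\<dots> = L\<^sup>2 * (\<integral>r. (h' j (x(j := r)))\<^sup>2 \<partial>cell)"
      using L_pos unfolding integral_cell[OF m2] by (simp add: power2_eq_square[of L])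
    also have "ennreal \<dots> = K j x"
      unfolding K_def \<phi>_def using i2
      by (subst nn_integral_eq_integral) (auto simp: ennreal_mult')
    finally show "ennreal ((h (x(j := s)) - h (x(j := s')))\<^sup>2) \<le> K j x" by (simp add: ennreal_leI)
  qed (use continuous_measurable_Q[OF cont] B Km AE_cell prob_space_cell in
        \<open>auto simp: Q_def[symmetric] simp del: atLeastAtMost_iff\<close>)
  also have "\<dots> = (\<Sum>j<n. ennreal (L\<^sup>2 * (\<integral>y. (h' j y)\<^sup>2 \<partial>Q)))"
  proof (rule sum.cong[OF refl])
    fix j assume "j \<in> {..<n}"
    then have j: "j < n" by simp
    show "(\<integral>\<^sup>+y. K j y \<partial>Q) = ennreal (L\<^sup>2 * (\<integral>y. (h' j y)\<^sup>2 \<partial>Q))"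
      unfolding intK[OF j] \<phi>_def
      by (subst nn_integral_eq_integral[OF integrable_Q[OF hc[OF j]]]) (auto simp: ennreal_mult')
  qed
  also have "\<dots> = ennreal (\<Sum>j<n. L\<^sup>2 * (\<integral>y. (h' j y)\<^sup>2 \<partial>Q))"
    by (intro sum_ennreal) auto
  finally show ?thesis
    by (subst (asm) ennreal_le_iff) (auto intro!: sum_nonneg simp: sum_distrib_left)
qed

section \<open>Box integrals: limits, linearity and the divergence theorem\<close>

lemma box_tendsto_integral:
  fixes f :: "(nat \<Rightarrow> real) \<Rightarrow> real"
  assumes f: "integrable P f"
  shows "(\<lambda>m. box (- real m) (real m) f) \<longlonglongrightarrow> (\<integral>x. f x \<partial>P)"
  unfolding box_def
proof (rule integral_dominated_convergence[where w = "\<lambda>x. \<bar>f x\<bar>"])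
  show "f \<in> borel_measurable P" using f by simp
  have n: "(\<lambda>x. x n) \<in> borel_measurable P" unfolding P_def by measurable
  show "(\<lambda>x. indicator {- real m..real m} (x n) * f x) \<in> borel_measurable P" for m
    using n f by measurable
  show "integrable P (\<lambda>x. \<bar>f x\<bar>)" using f by simp
  show "AE x in P. (\<lambda>m. indicator {- real m..real m} (x n) * f x) \<longlonglongrightarrow> f x"
  proof (rule AE_I2)
    fix x :: "nat \<Rightarrow> real"
    obtain N :: nat where "\<bar>x n\<bar> \<le> real N" using real_arch_simple by blast
    then have "\<forall>\<^sub>F m in sequentially. indicator {- real m..real m} (x n) * f x = f x"
      by (intro eventually_sequentiallyI[of N]) (auto simp: indicator_def)
    then show "(\<lambda>m. indicator {- real m..real m} (x n) * f x) \<longlonglongrightarrow> f x"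
      by (rule tendsto_eventually)
  qed
qed (auto simp: indicator_def)

lemma box_sum:
  assumes "\<And>j. j \<in> J \<Longrightarrow> continuous_on (points (Suc n)) (f j)"
  shows "box a b (\<lambda>x. \<Sum>j\<in>J. f j x) = (\<Sum>j\<in>J. box a b (f j))"
  unfolding box_def sum_distrib_left
  by (intro Bochner_Integration.integral_sum integrable_P_box assms)

lemma box_add:
  assumes "continuous_on (points (Suc n)) f" "continuous_on (points (Suc n)) h"
  shows "box a b (\<lambda>x. f x + h x) = box a b f + box a b h"
  unfolding box_def distrib_left
  by (intro Bochner_Integration.integral_add integrable_P_box assms)

lemma box_cmult: "box a b (\<lambda>x. c * f x) = c * box a b f"
  unfolding box_def by (subst integral_mult_right_zero[symmetric]) (simp add: mult.left_commute)

lemma box_diff: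
  assumes "continuous_on (points (Suc n)) f" "continuous_on (points (Suc n)) h"
  shows "box a b (\<lambda>x. f x - h x) = box a b f - box a b h"
  unfolding box_def right_diff_distrib
  by (intro Bochner_Integration.integral_diff integrable_P_box assms)

lemma box_mono:
  assumes "continuous_on (points (Suc n)) f" "continuous_on (points (Suc n)) h"
    and "\<And>x. x \<in> points (Suc n) \<Longrightarrow> f x \<le> h x"
  shows "box a b f \<le> box a b h"
  unfolding box_def
  by (intro integral_mono integrable_P_box assms) (auto intro!: mult_left_mono assms(3))

lemma box_cong:
  assumes "\<And>x. x \<in> points (Suc n) \<Longrightarrow> f x = h x"
  shows "box a b f = box a b h"
  unfolding box_def by (intro Bochner_Integration.integral_cong) (auto simp: assms)

text \<open>Periodicity cancels the lateral fluxes, so only those through the top and the bottom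
  survive.\<close>

lemma box_divergence:
  assumes C1: "\<And>i. i \<le> n \<Longrightarrow> dir_C1 (Suc n) i (F i) (F' i)"
    and per: "\<And>i x. i < n \<Longrightarrow> x \<in> points (Suc n) \<Longrightarrow> F i (x(i := x i + L)) = F i x"
    and ab: "a \<le> b"
  shows "box a b (\<lambda>x. \<Sum>i<Suc n. F' i x) = slice (F n) b - slice (F n) a"
proof -
  have "box a b (\<lambda>x. \<Sum>i<Suc n. F' i x) = (\<Sum>i<Suc n. box a b (F' i))"
    using C1 by (intro box_sum) (auto simp: dir_C1_def)
  also have "\<dots> = box a b (F' n)"
  proof -
    have "box a b (F' i) = 0" if "i < n" for i
    proof (rule box_horizontal_derivative)
      show "dir_C1 (Suc n) i (F i) (F' i)" using C1[of i] that by simp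
    qed (use that per in auto)
    then show ?thesis by simp
  qed
  also have "\<dots> = slice (F n) b - slice (F n) a"
    by (rule box_vertical_derivative[OF C1 ab]) simp
  finally show ?thesis .
qed

lemma slice_diff:
  assumes "continuous_on (points (Suc n)) f" "continuous_on (points (Suc n)) h"
  shows "slice (\<lambda>x. f x - h x) z = slice f z - slice h z"
  unfolding slice_def
  by (intro Bochner_Integration.integral_diff integrable_Q continuous_on_slice assms)

lemma slice_cmult: "slice (\<lambda>x. c * f x) z = c * slice f z"
  unfolding slice_def by simp

lemma slice_flux_tendsto:
  assumes "no_flux_at_infinity (Suc n) L F" "continuous_on (points (Suc n)) F"
  shows "(\<lambda>m. slice F (real m)) \<longlonglongrightarrow> 0" "(\<lambda>m. slice F (- real m)) \<longlonglongrightarrow> 0"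
proof -
  have e: "slice_avg (Suc n) L F = slice F" using slice_avg_eq[OF assms(2)] by auto
  show "(\<lambda>m. slice F (real m)) \<longlonglongrightarrow> 0"
    using assms(1) filterlim_compose[OF _ filterlim_real_sequentially]
    unfolding no_flux_at_infinity_def e by blast
  have "filterlim (\<lambda>m. - real m) at_bot sequentially"
    using filterlim_real_sequentially by (simp add: filterlim_uminus_at_bot)
  then show "(\<lambda>m. slice F (- real m)) \<longlonglongrightarrow> 0"
    using assms(1) filterlim_compose unfolding no_flux_at_infinity_def e by blast
qed

lemma box_le_integral:
  assumes "integrable P f" "\<And>x. x \<in> points (Suc n) \<Longrightarrow> f x \<ge> 0" "continuous_on (points (Suc n)) f"
  shows "box a b f \<le> (\<integral>x. f x \<partial>P)"
  unfolding box_def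
  by (rule integral_mono[OF integrable_P_box[OF assms(3)] assms(1)])
     (use assms(2) in \<open>auto simp: indicator_def\<close>)

lemma box_const: "a \<le> b \<Longrightarrow> box a b (\<lambda>x. c) = c * (b - a)"
  by (subst box_eq_slices(1)) (auto simp: slice_def Q.prob_space simp del: space_Q)

text \<open>The tangent inequality
  \<open>2 * \<mu> * v x - \<mu>\<^sup>2 \<le> (v x)\<^sup>2\<close> forces the integral of the
  square over a box of height \<open>2 * m\<close> to be at least
  \<open>2 * m * \<mu>\<^sup>2\<close>, which is unbounded in \<open>m\<close> unless \<mu> is
  zero.\<close>

lemma slice_const_eq_0:
  assumes c: "continuous_on (points (Suc n)) v" and const: "\<And>z. slice v z = \<mu>"
    and bound: "\<And>m. box (- real m) (real m) (\<lambda>x. (v x)\<^sup>2) \<le> M"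
  shows "\<mu> = 0"
proof (rule ccontr)
  assume "\<mu> \<noteq> 0"
  have le: "\<mu>\<^sup>2 * (2 * real m) \<le> M" for m
  proof -
    let ?B = "box (- real m) (real m)"
    have "?B v = \<mu> * (2 * real m)"
      by (subst box_eq_slices(1)[OF c]) (simp add: const)
    moreover have "?B (\<lambda>x. 2 * \<mu> * v x - \<mu>\<^sup>2) \<le> ?B (\<lambda>x. (v x)\<^sup>2)"
    proof (rule box_mono)
      fix x
      have "(v x - \<mu>)\<^sup>2 \<ge> 0" by simp
      then show "2 * \<mu> * v x - \<mu>\<^sup>2 \<le> (v x)\<^sup>2" by (simp add: power2_diff algebra_simps)
    qed (use c in \<open>auto intro!: continuous_intros\<close>)
    moreover have "?B (\<lambda>x. 2 * \<mu> * v x - \<mu>\<^sup>2) = 2 * \<mu> * ?B v - \<mu>\<^sup>2 * (2 * real m)"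
      using c by (subst box_diff) (auto intro!: continuous_intros simp: box_cmult box_const)
    ultimately show ?thesis using bound[of m] by (simp add: power2_eq_square)
  qed
  obtain m :: nat where "M / (2 * \<mu>\<^sup>2) < real m" using reals_Archimedean2 by blast
  then have "M < \<mu>\<^sup>2 * (2 * real m)" using \<open>\<mu> \<noteq> 0\<close> by (simp add: divide_less_eq algebra_simps)
  with le[of m] show False by simp
qed

lemma slice_dir_C1:
  assumes "dir_C1 (Suc n) j F F'" "j < n"
  shows "dir_C1 n j (\<lambda>y. F (y(n := z))) (\<lambda>y. F' (y(n := z)))"
  unfolding dir_C1_def
proof (intro conjI ballI)
  fix y assume "y \<in> points n"
  then have "((\<lambda>s. F ((y(n := z))(j := s))) has_real_derivative F' (y(n := z))) (at ((y(n := z)) j))"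
    using assms points_Suc_upd unfolding dir_C1_def by blast
  then show "((\<lambda>s. F ((y(j := s))(n := z))) has_real_derivative F' (y(n := z))) (at (y j))"
    using assms(2) by (simp add: fun_upd_twist)
qed (use assms in \<open>auto simp: dir_C1_def intro: continuous_on_slice\<close>)

text \<open>As \<open>v\<close> has mean zero, the slice mean \<open>c\<close> of \<open>h\<close>
  can be subtracted; then Young's inequality with weight \<kappa> and the Poincare inequality apply.
  Keeping \<kappa> free replaces a product of square roots by a bound linear in both integrals,
  which can be integrated over heights and passed to the limit.\<close>

lemma slice_correlation_le:
  assumes C1: "\<And>j. j < n \<Longrightarrow> dir_C1 (Suc n) j h (h' j)" and h: "continuous_on (points (Suc n)) h"
    and B: "\<And>x. x \<in> points (Suc n) \<Longrightarrow> \<bar>h x\<bar> \<le> B"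
    and v: "continuous_on (points (Suc n)) v" and mean: "slice v z = 0" and \<kappa>: "\<kappa> > 0"
  shows "\<bar>slice (\<lambda>x. h x * v x) z\<bar>
    \<le> (\<kappa> * L\<^sup>2 * (\<Sum>j<n. slice (\<lambda>x. (h' j x)\<^sup>2) z) + slice (\<lambda>x. (v x)\<^sup>2) z / \<kappa>) / 2"
proof -
  let ?h = "\<lambda>y. h (y(n := z))" and ?v = "\<lambda>y. v (y(n := z))"
  note hc = continuous_on_slice[OF h, of z] and vc = continuous_on_slice[OF v, of z]
  define c where "c = (\<integral>y. ?h y \<partial>Q)"
  have i: "integrable Q ?h" "integrable Q ?v" "integrable Q (\<lambda>y. (?h y)\<^sup>2)" "integrable Q (\<lambda>y. (?v y)\<^sup>2)"
    "integrable Q (\<lambda>y. ?h y * ?v y)"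
    using hc vc by (auto intro!: integrable_Q continuous_intros)
  have var: "(\<integral>y. (?h y)\<^sup>2 \<partial>Q) - c\<^sup>2 \<le> L\<^sup>2 * (\<Sum>j<n. slice (\<lambda>x. (h' j x)\<^sup>2) z)"
    unfolding c_def slice_def
    by (rule poincare_cube[where B = B]) (auto intro!: slice_dir_C1 C1 hc B points_Suc_upd)
  have mean': "(\<integral>y. ?v y \<partial>Q) = 0" using mean by (simp add: slice_def)
  have e: "(\<integral>y. (?h y - c) * ?v y \<partial>Q) = slice (\<lambda>x. h x * v x) z"
    unfolding left_diff_distrib slice_def using i mean' by simp
  \<comment> \<open>Young's bound with the square of \<open>?h y - c\<close> expanded, so that its
    integral turns into the variance of \<open>h\<close> on the slice.\<close>
  define R where "R y = (\<kappa> * ((?h y)\<^sup>2 - 2 * c * ?h y + c\<^sup>2) + (?v y)\<^sup>2 / \<kappa>) / 2" for y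
  have iR: "integrable Q R" unfolding R_def using i by auto
  have ii: "integrable Q (\<lambda>y. (?h y - c) * ?v y)" unfolding left_diff_distrib using i by auto
  have am: "\<bar>(?h y - c) * ?v y\<bar> \<le> R y" for y
  proof -
    define A where "A = sqrt \<kappa> * \<bar>?h y - c\<bar>"
    define B where "B = \<bar>?v y\<bar> / sqrt \<kappa>"
    have "(A - B)\<^sup>2 \<ge> 0" by simp
    then have "2 * (A * B) \<le> A\<^sup>2 + B\<^sup>2" by (simp add: power2_diff)
    moreover have "A * B = \<bar>(?h y - c) * ?v y\<bar>" using \<kappa> by (simp add: A_def B_def abs_mult)
    moreover have "A\<^sup>2 = \<kappa> * (?h y - c)\<^sup>2" "B\<^sup>2 = (?v y)\<^sup>2 / \<kappa>"
      using \<kappa> by (simp_all add: A_def B_def power_mult_distrib power_divide)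
    moreover have "R y = (\<kappa> * (?h y - c)\<^sup>2 + (?v y)\<^sup>2 / \<kappa>) / 2"
      by (simp add: R_def power2_diff algebra_simps)
    ultimately show ?thesis by simp
  qed
  have "\<bar>slice (\<lambda>x. h x * v x) z\<bar> \<le> (\<integral>y. R y \<partial>Q)"
    unfolding e[symmetric]
    by (rule order_trans[OF integral_abs_bound]) (intro integral_mono iR integrable_abs ii am)
  also have "\<dots> = (\<kappa> * ((\<integral>y. (?h y)\<^sup>2 \<partial>Q) - 2 * c * c + c\<^sup>2) + slice (\<lambda>x. (v x)\<^sup>2) z / \<kappa>) / 2"
    unfolding R_def slice_def using i by (simp add: Q.prob_space c_def[symmetric] del: space_Q)
  also have "\<dots> \<le> (\<kappa> * (L\<^sup>2 * (\<Sum>j<n. slice (\<lambda>x. (h' j x)\<^sup>2) z)) + slice (\<lambda>x. (v x)\<^sup>2) z / \<kappa>) / 2"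
    using var \<kappa> by (intro divide_right_mono add_right_mono mult_left_mono) (auto simp: power2_eq_square)
  finally show ?thesis by (simp add: mult.assoc)
qed

lemma box_correlation_le:
  assumes C1: "\<And>j. j < n \<Longrightarrow> dir_C1 (Suc n) j h (h' j)" and h: "continuous_on (points (Suc n)) h"
    and B: "\<And>x. x \<in> points (Suc n) \<Longrightarrow> \<bar>h x\<bar> \<le> B"
    and v: "continuous_on (points (Suc n)) v" and mean: "\<And>z. slice v z = 0" and \<kappa>: "\<kappa> > 0"
  shows "\<bar>box a b (\<lambda>x. h x * v x)\<bar>
    \<le> (\<kappa> * L\<^sup>2 * (\<Sum>j<n. box a b (\<lambda>x. (h' j x)\<^sup>2)) + box a b (\<lambda>x. (v x)\<^sup>2) / \<kappa>) / 2"
proof -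
  let ?I = "indicator {a..b} :: real \<Rightarrow> real"
  have c: "continuous_on (points (Suc n)) (\<lambda>x. h x * v x)" "continuous_on (points (Suc n)) (\<lambda>x. (v x)\<^sup>2)"
    "\<And>j. j < n \<Longrightarrow> continuous_on (points (Suc n)) (\<lambda>x. (h' j x)\<^sup>2)"
    using C1 h v by (auto intro!: continuous_intros simp: dir_C1_def)
  note i = box_eq_slices(2)[OF c(1), of a b] box_eq_slices(2)[OF c(2), of a b] box_eq_slices(2)[OF c(3), of _ a b]
  let ?R = "\<lambda>z. (\<kappa> * L\<^sup>2 * (\<Sum>j<n. ?I z * slice (\<lambda>x. (h' j x)\<^sup>2) z) + ?I z * slice (\<lambda>x. (v x)\<^sup>2) z / \<kappa>) / 2"
  have iR: "integrable lborel ?R"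
    using i by (intro Bochner_Integration.integrable_divide_zero Bochner_Integration.integrable_add
        integrable_mult_right Bochner_Integration.integrable_sum) auto
  have "\<bar>box a b (\<lambda>x. h x * v x)\<bar> \<le> (\<integral>z. \<bar>?I z * slice (\<lambda>x. h x * v x) z\<bar> \<partial>lborel)"
    unfolding box_eq_slices(1)[OF c(1)] by (rule integral_abs_bound)
  also have "\<dots> \<le> (\<integral>z. ?R z \<partial>lborel)"
  proof (intro integral_mono integrable_abs i iR)
    fix z
    show "\<bar>?I z * slice (\<lambda>x. h x * v x) z\<bar> \<le> ?R z"
      using slice_correlation_le[OF C1 h B v mean \<kappa>, of z]
      by (cases "z \<in> {a..b}") simp_all
  qed
  also have "\<dots> = (\<kappa> * L\<^sup>2 * (\<integral>z. (\<Sum>j<n. ?I z * slice (\<lambda>x. (h' j x)\<^sup>2) z) \<partial>lborel)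
      + box a b (\<lambda>x. (v x)\<^sup>2) / \<kappa>) / 2"
  proof -
    define S where "S z = (\<Sum>j<n. ?I z * slice (\<lambda>x. (h' j x)\<^sup>2) z)" for z
    have "integrable lborel S" unfolding S_def using i by (intro Bochner_Integration.integrable_sum) auto
    then show ?thesis using i(2) unfolding S_def[symmetric] box_eq_slices(1)[OF c(2)] by simp
  qed
  also have "(\<integral>z. (\<Sum>j<n. ?I z * slice (\<lambda>x. (h' j x)\<^sup>2) z) \<partial>lborel)
      = (\<Sum>j<n. box a b (\<lambda>x. (h' j x)\<^sup>2))"
    using i by (subst Bochner_Integration.integral_sum) (simp_all add: box_eq_slices(1)[OF c(3)])
  finally show ?thesis .
qed

end

subsection \<open>Energy identities\<close>

locale flow = strip_domain n L for n L +
  fixes g \<rho>m \<rho>p :: real and \<rho> :: "real \<Rightarrow> (nat \<Rightarrow> real) \<Rightarrow> real"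
    and u :: "real \<Rightarrow> (nat \<Rightarrow> real) \<Rightarrow> nat \<Rightarrow> real" and p :: "real \<Rightarrow> (nat \<Rightarrow> real) \<Rightarrow> real"
  assumes g_pos: "g > 0" and \<rho>m_pos: "\<rho>m > 0" and \<rho>_less: "\<rho>m < \<rho>p"
    and sol: "classical_solution (Suc n) L g \<rho>m \<rho>p \<rho> u p"
begin

abbreviation pts :: "(nat \<Rightarrow> real) set" where "pts \<equiv> points (Suc n)"

lemma sol_parts:
  "solution_regular (Suc n) \<rho> u p" "solution_periodic (Suc n) L \<rho> u p" "transport_equation (Suc n) \<rho> u"
  "momentum_equation (Suc n) g \<rho> u p" "incompressible (Suc n) u" "density_range (Suc n) \<rho>m \<rho>p \<rho>"
  "far_field (Suc n) \<rho>m \<rho>p \<rho> u" "regular_bulk (Suc n) L (potential_density (Suc n) g \<rho>m \<rho>p \<rho>)"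
  "regular_bulk (Suc n) L (kinetic_density (Suc n) \<rho> u)" "regular_bulk (Suc n) L (mixing_density \<rho>m \<rho>p \<rho>)"
  "no_boundary_terms (Suc n) L \<rho>m \<rho>p \<rho> u p"
  using sol by (auto simp: classical_solution_def)

text \<open>Written with products instead of squares so that the product rules apply to it
  directly.\<close>

definition vel_sq :: "real \<Rightarrow> (nat \<Rightarrow> real) \<Rightarrow> real" where
  "vel_sq t x = (\<Sum>j<Suc n. u t x j * u t x j)"

lemma L2_set_sq: "(L2_set (u t x) {..<Suc n})\<^sup>2 = vel_sq t x"
  unfolding L2_set_def vel_sq_def by (subst real_sqrt_pow2) (auto simp: sum_nonneg power2_eq_square)

section \<open>Regularity, periodicity and the pointwise equations at a fixed positive time\<close>

context
  fixes t :: real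
  assumes t_pos: "t > 0"
begin

lemma continuous_on_time_slice:
  assumes "continuous_on ({0<..} \<times> pts) (\<lambda>(t, x). f t x :: real)"
  shows "continuous_on pts (f t)"
proof -
  have "continuous_on pts ((\<lambda>(t, x). f t x) \<circ> (\<lambda>x. (t, x)))"
    by (intro continuous_on_compose continuous_on_subset[OF assms] continuous_intros)
       (use t_pos in auto)
  then show ?thesis by (simp add: comp_def)
qed

lemma dir_C1_pd:
  assumes "\<And>i x. i \<le> n \<Longrightarrow> x \<in> pts \<Longrightarrow> pd_exists i F x"
    and "\<And>i. i \<le> n \<Longrightarrow> continuous_on pts (pd i F)" and i: "i \<le> n"
  shows "dir_C1 (Suc n) i F (pd i F)"
  unfolding dir_C1_def
proof (intro conjI ballI)
  show "continuous_on pts F" by (rule continuous_on_points_if_pd) (use assms in auto)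
qed (use assms pd_has_derivative in auto)

lemma continuous_derivatives:
  assumes "i \<le> n"
  shows "continuous_on pts (pd i (\<rho> t))" "continuous_on pts (pd i (pd i (\<rho> t)))"
    "continuous_on pts (pd i (p t))" "j \<le> n \<Longrightarrow> continuous_on pts (pd i (\<lambda>x. u t x j))"
  using sol_parts(1) assms unfolding solution_regular_def
  by (auto intro!: continuous_on_time_slice simp: less_Suc_eq_le)

lemma continuous_td: "continuous_on pts (td \<rho> t)"
  "j \<le> n \<Longrightarrow> continuous_on pts (td (\<lambda>t x. u t x j) t)"
  using sol_parts(1) unfolding solution_regular_def
  by (auto intro!: continuous_on_time_slice simp: less_Suc_eq_le)

lemma density_C1: "i \<le> n \<Longrightarrow> dir_C1 (Suc n) i (\<rho> t) (pd i (\<rho> t))"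
  using sol_parts(1) t_pos unfolding solution_regular_def
  by (intro dir_C1_pd continuous_derivatives) (auto simp: less_Suc_eq_le)

lemma velocity_C1: "i \<le> n \<Longrightarrow> j \<le> n \<Longrightarrow> dir_C1 (Suc n) i (\<lambda>x. u t x j) (pd i (\<lambda>x. u t x j))"
  using sol_parts(1) t_pos unfolding solution_regular_def
  by (intro dir_C1_pd continuous_derivatives) (auto simp: less_Suc_eq_le)

lemma pressure_C1: "i \<le> n \<Longrightarrow> dir_C1 (Suc n) i (p t) (pd i (p t))"
  using sol_parts(1) t_pos unfolding solution_regular_def
  by (intro dir_C1_pd continuous_derivatives) (auto simp: less_Suc_eq_le)

lemma density_pd_C1: "i \<le> n \<Longrightarrow> dir_C1 (Suc n) i (pd i (\<rho> t)) (pd i (pd i (\<rho> t)))"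
  using sol_parts(1) t_pos unfolding solution_regular_def dir_C1_def
  by (auto simp: less_Suc_eq_le continuous_derivatives intro!: pd_has_derivative)

lemma continuous_fields [continuous_intros]:
  "continuous_on pts (\<rho> t)" "continuous_on pts (p t)"
  "j \<le> n \<Longrightarrow> continuous_on pts (\<lambda>x. u t x j)" "continuous_on pts (vel_sq t)"
proof -
  show u: "j \<le> n \<Longrightarrow> continuous_on pts (\<lambda>x. u t x j)" for j
    using velocity_C1[of 0 j] by (simp add: dir_C1_def)
  show "continuous_on pts (\<rho> t)" "continuous_on pts (p t)"
    using density_C1[of 0] pressure_C1[of 0] by (auto simp: dir_C1_def)
  show "continuous_on pts (vel_sq t)"
    unfolding vel_sq_def[abs_def] by (auto intro!: continuous_intros u)
qed

lemma continuous_coordinate [continuous_intros]: "continuous_on A (\<lambda>x::nat \<Rightarrow> real. x i)"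
  by (rule continuous_on_subset[OF continuous_on_product_coordinates]) simp

lemma periodic_fields:
  assumes "i < n" "x \<in> pts"
  shows "\<rho> t (x(i := x i + L)) = \<rho> t x" "j \<le> n \<Longrightarrow> u t (x(i := x i + L)) j = u t x j"
    "p t (x(i := x i + L)) = p t x" "pd i (\<rho> t) (x(i := x i + L)) = pd i (\<rho> t) x"
proof -
  have per: "\<rho> t (x(i := x i + L)) = \<rho> t x" if "x \<in> pts" for x
    using sol_parts(2) t_pos assms that unfolding solution_periodic_def y_periodic_def by auto
  show "\<rho> t (x(i := x i + L)) = \<rho> t x" by (rule per[OF assms(2)])
  show "j \<le> n \<Longrightarrow> u t (x(i := x i + L)) j = u t x j" "p t (x(i := x i + L)) = p t x"
    using sol_parts(2) t_pos assms unfolding solution_periodic_def y_periodic_def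
    by (auto simp: less_Suc_eq_le)
  show "pd i (\<rho> t) (x(i := x i + L)) = pd i (\<rho> t) x"
    by (rule dir_C1_periodic[where F = "\<rho> t"]) (use density_C1[of i] assms per in auto)
qed

lemma density_bounds: "x \<in> pts \<Longrightarrow> \<rho>m < \<rho> t x \<and> \<rho> t x < \<rho>p"
  using sol_parts(6) t_pos by (auto simp: density_range_def)

lemma transport:
  "x \<in> pts \<Longrightarrow> (\<Sum>i<Suc n. pd i (pd i (\<rho> t)) x) - (\<Sum>i<Suc n. u t x i * pd i (\<rho> t) x) = td \<rho> t x"
  using sol_parts(3) t_pos unfolding transport_equation_def by (auto simp: algebra_simps)

lemma divergence_free: "x \<in> pts \<Longrightarrow> (\<Sum>i<Suc n. pd i (\<lambda>x. u t x i) x) = 0"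
  using sol_parts(5) t_pos unfolding incompressible_def by auto

lemma time_derivatives:
  assumes "x \<in> pts"
  shows "((\<lambda>s. \<rho> s x) has_real_derivative td \<rho> t x) (at t)"
    "j \<le> n \<Longrightarrow> ((\<lambda>s. u s x j) has_real_derivative td (\<lambda>t x. u t x j) t x) (at t)"
  using sol_parts(1) t_pos assms unfolding solution_regular_def td_def
  by (auto simp: DERIV_deriv_iff_real_differentiable less_Suc_eq_le)

lemma td_potential:
  assumes x: "x \<in> pts"
  shows "td (potential_density (Suc n) g \<rho>m \<rho>p \<rho>) t x = - (g * (x n * td \<rho> t x))"
  unfolding td_def[of "potential_density _ _ _ _ _"] potential_density_def
  by (rule DERIV_imp_deriv) (auto intro!: derivative_eq_intros time_derivatives[OF x])

lemma td_mixing: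
  assumes x: "x \<in> pts"
  shows "td (mixing_density \<rho>m \<rho>p \<rho>) t x = (\<rho>p + \<rho>m - 2 * \<rho> t x) * td \<rho> t x"
  unfolding td_def[of "mixing_density _ _ _"] mixing_density_def
  by (rule DERIV_imp_deriv) (auto intro!: derivative_eq_intros time_derivatives[OF x] simp: algebra_simps)

lemma td_kinetic:
  assumes x: "x \<in> pts"
  shows "td (kinetic_density (Suc n) \<rho> u) t x = td \<rho> t x * vel_sq t x
    + (\<Sum>j<Suc n. 2 * u t x j * (\<rho> t x * td (\<lambda>t x. u t x j) t x))"
proof -
  have "((\<lambda>s. \<rho> s x * (\<Sum>j<Suc n. u s x j * u s x j)) has_real_derivative
      td \<rho> t x * (\<Sum>j<Suc n. u t x j * u t x j)
        + (\<Sum>j<Suc n. td (\<lambda>t x. u t x j) t x * u t x j + td (\<lambda>t x. u t x j) t x * u t x j) * \<rho> t x) (at t)"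
    by (intro DERIV_mult DERIV_sum time_derivatives[OF x]) auto
  then have "((\<lambda>s. kinetic_density (Suc n) \<rho> u s x) has_real_derivative td \<rho> t x * vel_sq t x
    + (\<Sum>j<Suc n. 2 * u t x j * (\<rho> t x * td (\<lambda>t x. u t x j) t x))) (at t)"
    unfolding kinetic_density_def L2_set_sq vel_sq_def
    by (simp add: sum_distrib_right sum_distrib_left algebra_simps del: sum.lessThan_Suc)
  then show ?thesis
    unfolding td_def[of "kinetic_density _ _ _"] by (rule DERIV_imp_deriv)
qed

lemma momentum:
  assumes "x \<in> pts" "j \<le> n"
  shows "\<rho> t x * td (\<lambda>t x. u t x j) t x
    = (\<Sum>i<Suc n. pd i (\<rho> t) x * pd i (\<lambda>x. u t x j) x) - \<rho> t x * (\<Sum>i<Suc n. u t x i * pd i (\<lambda>x. u t x j) x)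
      - pd j (p t) x - (if j = n then \<rho> t x * g else 0)"
proof -
  have "\<rho> t x * (td (\<lambda>t x. u t x j) t x + (\<Sum>i<Suc n. u t x i * pd i (\<lambda>x. u t x j) x))
     - (\<Sum>i<Suc n. pd i (\<rho> t) x * pd i (\<lambda>x. u t x j) x)
     + pd j (p t) x + \<rho> t x * g * (if j = Suc n - 1 then 1 else 0) = 0"
    using sol_parts(4) t_pos assms unfolding momentum_equation_def by (auto simp del: sum.lessThan_Suc)
  then show ?thesis by (auto simp: algebra_simps simp del: sum.lessThan_Suc split: if_splits)
qed

section \<open>Time derivatives of the bulk integrals as limits of box integrals\<close>

lemma integrable_bulk:
  "regular_bulk (Suc n) L f \<Longrightarrow> f t \<in> borel_measurable P \<Longrightarrow> integrable P (f t)"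
  "regular_bulk (Suc n) L f \<Longrightarrow> td f t \<in> borel_measurable P \<Longrightarrow> integrable P (td f t)"
  using t_pos strip_integrable_iff[of "f t"] strip_integrable_iff[of "td f t"]
  unfolding regular_bulk_def by auto

text \<open>Only the full time derivative is known to be integrable. Once the equations rewrite it
  as \<open>h\<close>, the box integrals of \<open>h\<close> converge as a whole, and the limit of
  any one term follows when the others are controlled.\<close>

lemma bulk_derivative:
  assumes f: "regular_bulk (Suc n) L f" and c: "continuous_on pts h"
    and h: "\<And>x. x \<in> pts \<Longrightarrow> td f t x = h x"
  shows "((\<lambda>s. strip_avg (Suc n) L (f s)) has_real_derivative strip_avg (Suc n) L (td f t)) (at t)"
    and "(\<lambda>m. box (- real m) (real m) h) \<longlonglongrightarrow> strip_avg (Suc n) L (td f t)"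
proof -
  show "((\<lambda>s. strip_avg (Suc n) L (f s)) has_real_derivative strip_avg (Suc n) L (td f t)) (at t)"
    using f t_pos by (auto simp: regular_bulk_def)
  have "continuous_on pts (td f t)" using c h continuous_on_cong by metis
  then have m: "td f t \<in> borel_measurable P" by (rule continuous_measurable_P)
  have "(\<lambda>k. box (- real k) (real k) (td f t)) \<longlonglongrightarrow> strip_avg (Suc n) L (td f t)"
    unfolding strip_avg_eq[OF m] by (rule box_tendsto_integral[OF integrable_bulk(2)[OF f m]])
  moreover have "box (- real k) (real k) (td f t) = box (- real k) (real k) h" for k
    by (rule box_cong[OF h])
  ultimately show "(\<lambda>m. box (- real m) (real m) h) \<longlonglongrightarrow> strip_avg (Suc n) L (td f t)" by simp
qed

lemma fluxes:
  "no_flux_at_infinity (Suc n) L (\<lambda>x. x n * pd n (\<rho> t) x)"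
  "no_flux_at_infinity (Suc n) L (\<lambda>x. x n * \<rho> t x * u t x n)"
  "no_flux_at_infinity (Suc n) L (\<lambda>x. vel_sq t x * pd n (\<rho> t) x)"
  "no_flux_at_infinity (Suc n) L (\<lambda>x. vel_sq t x * \<rho> t x * u t x n)"
  "no_flux_at_infinity (Suc n) L (\<lambda>x. p t x * u t x n)"
  "no_flux_at_infinity (Suc n) L (\<lambda>x. (\<rho>p + \<rho>m - 2 * \<rho> t x) * pd n (\<rho> t) x)"
  "no_flux_at_infinity (Suc n) L (\<lambda>x. (\<rho>p - \<rho> t x) * (\<rho> t x - \<rho>m) * u t x n)"
  using sol_parts(11) t_pos unfolding no_boundary_terms_def L2_set_sq by auto

lemma flux_divergence_tendsto:
  assumes C1: "\<And>i. i \<le> n \<Longrightarrow> dir_C1 (Suc n) i (F i) (F' i)"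
    and per: "\<And>i x. i < n \<Longrightarrow> x \<in> pts \<Longrightarrow> F i (x(i := x i + L)) = F i x"
    and lim: "(\<lambda>m. slice (F n) (real m)) \<longlonglongrightarrow> 0" "(\<lambda>m. slice (F n) (- real m)) \<longlonglongrightarrow> 0"
  shows "(\<lambda>m. box (- real m) (real m) (\<lambda>x. \<Sum>i<Suc n. F' i x)) \<longlonglongrightarrow> 0"
proof -
  have "box (- real m) (real m) (\<lambda>x. \<Sum>i<Suc n. F' i x) = slice (F n) (real m) - slice (F n) (- real m)" for m
    by (rule box_divergence[where F = F and F' = F']) (use C1 per in auto)
  then show ?thesis using tendsto_diff[OF lim] by simp
qed

text \<open>Dominated convergence on the probability space \<open>Q\<close>, with the constant bound
  \<rho>p. This produces the density jump, the one boundary term that does not vanish.\<close>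

lemma slice_density_tendsto:
  "(\<lambda>m. slice (\<rho> t) (real m)) \<longlonglongrightarrow> \<rho>p" "(\<lambda>m. slice (\<rho> t) (- real m)) \<longlonglongrightarrow> \<rho>m"
proof -
  have *: "(\<lambda>m. slice (\<rho> t) (s m)) \<longlonglongrightarrow> r"
    if "\<And>y. y \<in> points n \<Longrightarrow> (\<lambda>m. \<rho> t (y(n := s m))) \<longlonglongrightarrow> r" for s r
  proof -
    have "(\<lambda>m. \<integral>y. \<rho> t (y(n := s m)) \<partial>Q) \<longlonglongrightarrow> (\<integral>y. r \<partial>Q)"
    proof (rule integral_dominated_convergence[where w = "\<lambda>_. \<rho>p"])
      show "AE y in Q. norm (\<rho> t (y(n := s m))) \<le> \<rho>p" for m
      proof (rule AE_I2)
        fix y assume "y \<in> space Q"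
        then show "norm (\<rho> t (y(n := s m))) \<le> \<rho>p"
          using density_bounds[of "y(n := s m)"] \<rho>m_pos by (simp add: points_Suc_upd)
      qed
      show "AE y in Q. (\<lambda>m. \<rho> t (y(n := s m))) \<longlonglongrightarrow> r" using that by (intro AE_I2) auto
    qed (auto intro!: continuous_measurable_Q continuous_on_slice continuous_fields)
    then show ?thesis by (simp add: slice_def Q.prob_space del: space_Q)
  qed
  have ff: "((\<lambda>z. \<rho> t (y(n := z))) \<longlongrightarrow> \<rho>p) at_top" "((\<lambda>z. \<rho> t (y(n := z))) \<longlongrightarrow> \<rho>m) at_bot"
    if "y \<in> points n" for y
    using sol_parts(7)[unfolded far_field_def, rule_format, of t "y(n := 0)"] t_pos that
    by (simp_all add: points_Suc_upd)
  show "(\<lambda>m. slice (\<rho> t) (real m)) \<longlonglongrightarrow> \<rho>p"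
    by (intro * filterlim_compose[OF ff(1) filterlim_real_sequentially])
  have "filterlim (\<lambda>m. - real m) at_bot sequentially"
    using filterlim_real_sequentially by (simp add: filterlim_uminus_at_bot)
  then show "(\<lambda>m. slice (\<rho> t) (- real m)) \<longlonglongrightarrow> \<rho>m"
    by (intro * filterlim_compose[OF ff(2)])
qed

text \<open>Defined from the derivative of the potential, so that its existence needs no
  integrability of \<open>\<rho> t x * u t x n\<close>; the next lemma identifies it as the limit of
  the box integrals of that product.\<close>

definition buoyancy :: real where
  "buoyancy = (\<rho>p - \<rho>m) - strip_avg (Suc n) L (td (potential_density (Suc n) g \<rho>m \<rho>p \<rho>) t) / g"

lemma buoyancy_flux_tendsto:
  "(\<lambda>m. box (- real m) (real m) (\<lambda>x. \<rho> t x * u t x n)) \<longlonglongrightarrow> buoyancy"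
proof -
  let ?B = "\<lambda>m. box (- real m) (real m)"
  \<comment> \<open>The flux z (grad \<rho> - \<rho> u). By the transport equation and
    incompressibility its divergence is the vertical derivative of \<rho>, minus \<rho> times the
    vertical velocity, plus z times the time derivative of \<rho>.\<close>
  define F where "F i x = x n * pd i (\<rho> t) x - x n * \<rho> t x * u t x i" for i x
  define F' where "F' i x = ((if n = i then 1 else 0) * pd i (\<rho> t) x + x n * pd i (pd i (\<rho> t)) x)
    - (((if n = i then 1 else 0) * \<rho> t x + x n * pd i (\<rho> t) x) * u t x i
       + x n * \<rho> t x * pd i (\<lambda>x. u t x i) x)" for i x
  have C1: "dir_C1 (Suc n) i (F i) (F' i)" if "i \<le> n" for i
    unfolding F_def[abs_def] F'_def[abs_def] using that
    by (intro dir_C1_diff dir_C1_mult dir_C1_coordinate density_C1 density_pd_C1 velocity_C1)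
  have c: "continuous_on pts (\<lambda>x. x n * pd n (\<rho> t) x)" "continuous_on pts (\<lambda>x. x n * \<rho> t x * u t x n)"
    "continuous_on pts (\<lambda>x. \<rho> t x * u t x n)" "continuous_on pts (\<lambda>x. x n * td \<rho> t x)"
    by (auto intro!: continuous_intros continuous_derivatives continuous_td)
  have sF: "slice (F n) z = slice (\<lambda>x. x n * pd n (\<rho> t) x) z - slice (\<lambda>x. x n * \<rho> t x * u t x n) z" for z
    unfolding F_def[abs_def] by (rule slice_diff[OF c(1,2)])
  have div: "(\<lambda>m. ?B m (\<lambda>x. \<Sum>i<Suc n. F' i x)) \<longlonglongrightarrow> 0"
  proof (rule flux_divergence_tendsto[where F = F and F' = F'])
    show "dir_C1 (Suc n) i (F i) (F' i)" if "i \<le> n" for i by (rule C1[OF that])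
    show "F i (x(i := x i + L)) = F i x" if "i < n" "x \<in> pts" for i x
      using that by (simp add: F_def periodic_fields)
    show "(\<lambda>m. slice (F n) (real m)) \<longlonglongrightarrow> 0" "(\<lambda>m. slice (F n) (- real m)) \<longlonglongrightarrow> 0"
      unfolding sF
      using tendsto_diff[OF slice_flux_tendsto(1)[OF fluxes(1) c(1)] slice_flux_tendsto(1)[OF fluxes(2) c(2)]]
        tendsto_diff[OF slice_flux_tendsto(2)[OF fluxes(1) c(1)] slice_flux_tendsto(2)[OF fluxes(2) c(2)]]
      by simp_all
  qed
  have sum: "(\<Sum>i<Suc n. F' i x) = pd n (\<rho> t) x - \<rho> t x * u t x n + x n * td \<rho> t x" if x: "x \<in> pts" for x
  proof -
    have "(\<Sum>i<Suc n. F' i x) = (\<Sum>i<Suc n. if n = i then pd i (\<rho> t) x - \<rho> t x * u t x i else 0)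
       + x n * ((\<Sum>i<Suc n. pd i (pd i (\<rho> t)) x) - (\<Sum>i<Suc n. u t x i * pd i (\<rho> t) x))
       - x n * \<rho> t x * (\<Sum>i<Suc n. pd i (\<lambda>x. u t x i) x)"
      unfolding F'_def sum_distrib_left right_diff_distrib sum.distrib[symmetric] sum_subtractf[symmetric]
      by (rule sum.cong) (auto simp: algebra_simps)
    then show ?thesis unfolding transport[OF x] divergence_free[OF x] by simp
  qed
  have flux: "?B m (\<lambda>x. \<rho> t x * u t x n) = (slice (\<rho> t) (real m) - slice (\<rho> t) (- real m))
      + ?B m (\<lambda>x. x n * td \<rho> t x) - ?B m (\<lambda>x. \<Sum>i<Suc n. F' i x)" for m
  proof -
    have "?B m (\<lambda>x. \<Sum>i<Suc n. F' i x) = ?B m (\<lambda>x. pd n (\<rho> t) x - \<rho> t x * u t x n + x n * td \<rho> t x)"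
      by (rule box_cong[OF sum])
    also have "\<dots> = ?B m (pd n (\<rho> t)) - ?B m (\<lambda>x. \<rho> t x * u t x n) + ?B m (\<lambda>x. x n * td \<rho> t x)"
      using c by (simp add: box_add box_diff continuous_derivatives continuous_on_diff)
    also have "?B m (pd n (\<rho> t)) = slice (\<rho> t) (real m) - slice (\<rho> t) (- real m)"
      by (rule box_vertical_derivative[OF density_C1]) auto
    finally show ?thesis by simp
  qed
  have "(\<lambda>m. ?B m (\<lambda>x. - (g * (x n * td \<rho> t x))))
      \<longlonglongrightarrow> strip_avg (Suc n) L (td (potential_density (Suc n) g \<rho>m \<rho>p \<rho>) t)"
    by (rule bulk_derivative(2)[OF sol_parts(8) _ td_potential]) (use c in \<open>auto intro!: continuous_intros\<close>)
  from tendsto_mult_left[OF this, of "- (1 / g)"]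
  have "(\<lambda>m. ?B m (\<lambda>x. x n * td \<rho> t x))
      \<longlonglongrightarrow> - (strip_avg (Suc n) L (td (potential_density (Suc n) g \<rho>m \<rho>p \<rho>) t) / g)"
    unfolding box_cmult[symmetric] using g_pos by simp
  from tendsto_diff[OF tendsto_add[OF tendsto_diff[OF slice_density_tendsto] this] div]
  show ?thesis unfolding flux buoyancy_def by simp
qed

lemma potential_derivative:
  "((\<lambda>s. strip_avg (Suc n) L (potential_density (Suc n) g \<rho>m \<rho>p \<rho> s)) has_real_derivative
     g * ((\<rho>p - \<rho>m) - buoyancy)) (at t)"
proof -
  have "continuous_on pts (\<lambda>x. - (g * (x n * td \<rho> t x)))"
    by (auto intro!: continuous_intros continuous_td)
  from bulk_derivative(1)[OF sol_parts(8) this td_potential] show ?thesis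
    using g_pos by (simp add: buoyancy_def)
qed

text \<open>The cross term (grad \<rho> . grad) u, tested with 2 u, gives the gradient of \<rho>
  against that of \<open>vel_sq\<close>. Together with \<open>vel_sq\<close> times the Laplacian of
  \<rho> this is an exact divergence, as are the convective and pressure terms, so only the work of
  gravity remains.\<close>

lemma kinetic_derivative:
  "((\<lambda>s. strip_avg (Suc n) L (kinetic_density (Suc n) \<rho> u s)) has_real_derivative - 2 * g * buoyancy) (at t)"
proof -
  let ?B = "\<lambda>m. box (- real m) (real m)"
  define q where "q i x = (\<Sum>j<Suc n. pd i (\<lambda>x. u t x j) x * u t x j + u t x j * pd i (\<lambda>x. u t x j) x)" for i x
  define F where "F i x = vel_sq t x * pd i (\<rho> t) x - vel_sq t x * \<rho> t x * u t x i - 2 * (p t x * u t x i)" for i x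
  \<comment> \<open>Spelled out in the shape in which the \<open>dir_C1\<close> rules deliver it,
    including the vanishing derivative of the constant 2.\<close>
  define F' where "F' i x = (q i x * pd i (\<rho> t) x + vel_sq t x * pd i (pd i (\<rho> t)) x)
    - ((q i x * \<rho> t x + vel_sq t x * pd i (\<rho> t) x) * u t x i + vel_sq t x * \<rho> t x * pd i (\<lambda>x. u t x i) x)
    - (0 * (p t x * u t x i) + 2 * (pd i (p t) x * u t x i + p t x * pd i (\<lambda>x. u t x i) x))" for i x
  have q: "dir_C1 (Suc n) i (vel_sq t) (q i)" if "i \<le> n" for i
    unfolding vel_sq_def[abs_def] q_def[abs_def] using that
    by (intro dir_C1_sum dir_C1_mult velocity_C1) auto
  have C1: "dir_C1 (Suc n) i (F i) (F' i)" if "i \<le> n" for i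
    unfolding F_def[abs_def] F'_def[abs_def] using that
    by (intro dir_C1_diff dir_C1_mult dir_C1_const q density_C1 density_pd_C1 velocity_C1 pressure_C1)
  have c: "continuous_on pts (\<lambda>x. vel_sq t x * pd n (\<rho> t) x)"
    "continuous_on pts (\<lambda>x. vel_sq t x * \<rho> t x * u t x n)" "continuous_on pts (\<lambda>x. p t x * u t x n)"
    "continuous_on pts (\<lambda>x. \<rho> t x * u t x n)"
    by (auto intro!: continuous_intros continuous_derivatives)
  have cF': "continuous_on pts (\<lambda>x. \<Sum>i<Suc n. F' i x)"
    using C1 by (intro continuous_on_sum) (auto simp: dir_C1_def)
  have sF: "slice (F n) z = slice (\<lambda>x. vel_sq t x * pd n (\<rho> t) x) z
      - slice (\<lambda>x. vel_sq t x * \<rho> t x * u t x n) z - 2 * slice (\<lambda>x. p t x * u t x n) z" for z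
    unfolding F_def[abs_def] using c
    by (simp add: slice_diff slice_cmult continuous_on_diff continuous_on_mult_left)
  have div: "(\<lambda>m. ?B m (\<lambda>x. \<Sum>i<Suc n. F' i x)) \<longlonglongrightarrow> 0"
  proof (rule flux_divergence_tendsto[where F = F and F' = F'])
    show "dir_C1 (Suc n) i (F i) (F' i)" if "i \<le> n" for i by (rule C1[OF that])
    show "F i (x(i := x i + L)) = F i x" if "i < n" "x \<in> pts" for i x
    proof -
      have "vel_sq t (x(i := x i + L)) = vel_sq t x"
        unfolding vel_sq_def using that by (intro sum.cong) (auto simp: periodic_fields)
      then show ?thesis using that by (simp add: F_def periodic_fields)
    qed
    show "(\<lambda>m. slice (F n) (real m)) \<longlonglongrightarrow> 0" "(\<lambda>m. slice (F n) (- real m)) \<longlonglongrightarrow> 0"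
      unfolding sF
      using tendsto_diff[OF tendsto_diff[OF slice_flux_tendsto(1)[OF fluxes(3) c(1)] slice_flux_tendsto(1)[OF fluxes(4) c(2)]]
          tendsto_mult_left[OF slice_flux_tendsto(1)[OF fluxes(5) c(3)], of 2]]
        tendsto_diff[OF tendsto_diff[OF slice_flux_tendsto(2)[OF fluxes(3) c(1)] slice_flux_tendsto(2)[OF fluxes(4) c(2)]]
          tendsto_mult_left[OF slice_flux_tendsto(2)[OF fluxes(5) c(3)], of 2]]
      by simp_all
  qed
  have td: "td (kinetic_density (Suc n) \<rho> u) t x = (\<Sum>i<Suc n. F' i x) - 2 * g * (\<rho> t x * u t x n)"
    if x: "x \<in> pts" for x
  proof -
    have "(\<Sum>j<Suc n. 2 * u t x j * (\<rho> t x * td (\<lambda>t x. u t x j) t x))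
      = (\<Sum>j<Suc n. 2 * u t x j * ((\<Sum>i<Suc n. pd i (\<rho> t) x * pd i (\<lambda>x. u t x j) x)
          - \<rho> t x * (\<Sum>i<Suc n. u t x i * pd i (\<lambda>x. u t x j) x)
          - pd j (p t) x - (if j = n then \<rho> t x * g else 0)))"
      using momentum[OF x] by (intro sum.cong refl) (simp add: less_Suc_eq_le)
    also have "\<dots> = (\<Sum>j<Suc n. \<Sum>i<Suc n. pd i (\<rho> t) x * (2 * u t x j * pd i (\<lambda>x. u t x j) x))
        - (\<Sum>j<Suc n. \<Sum>i<Suc n. \<rho> t x * u t x i * (2 * u t x j * pd i (\<lambda>x. u t x j) x))
        - (\<Sum>j<Suc n. 2 * (pd j (p t) x * u t x j)) - (\<Sum>j<Suc n. if j = n then 2 * g * (\<rho> t x * u t x j) else 0)"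
      unfolding sum_subtractf[symmetric]
      by (rule sum.cong[OF refl]) (auto simp: right_diff_distrib sum_distrib_left sum_subtractf mult_ac simp del: sum.lessThan_Suc)
    also have "(\<Sum>j<Suc n. \<Sum>i<Suc n. pd i (\<rho> t) x * (2 * u t x j * pd i (\<lambda>x. u t x j) x))
        = (\<Sum>i<Suc n. q i x * pd i (\<rho> t) x)"
      unfolding q_def by (subst sum.swap)
        (auto intro!: sum.cong simp: sum_distrib_left sum_distrib_right algebra_simps simp del: sum.lessThan_Suc)
    also have "(\<Sum>j<Suc n. \<Sum>i<Suc n. \<rho> t x * u t x i * (2 * u t x j * pd i (\<lambda>x. u t x j) x))
        = (\<Sum>i<Suc n. q i x * \<rho> t x * u t x i)"
      unfolding q_def by (subst sum.swap)
        (auto intro!: sum.cong simp: sum_distrib_left sum_distrib_right algebra_simps simp del: sum.lessThan_Suc)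
    also have "(\<Sum>j<Suc n. if j = n then 2 * g * (\<rho> t x * u t x j) else 0) = 2 * g * (\<rho> t x * u t x n)"
      by simp
    finally have mom: "(\<Sum>j<Suc n. 2 * u t x j * (\<rho> t x * td (\<lambda>t x. u t x j) t x))
      = (\<Sum>i<Suc n. q i x * pd i (\<rho> t) x) - (\<Sum>i<Suc n. q i x * \<rho> t x * u t x i)
        - (\<Sum>j<Suc n. 2 * (pd j (p t) x * u t x j)) - 2 * g * (\<rho> t x * u t x n)" .
    have "(\<Sum>i<Suc n. F' i x) = (\<Sum>i<Suc n. q i x * pd i (\<rho> t) x) - (\<Sum>i<Suc n. q i x * \<rho> t x * u t x i)
        - (\<Sum>j<Suc n. 2 * (pd j (p t) x * u t x j))
        + vel_sq t x * ((\<Sum>i<Suc n. pd i (pd i (\<rho> t)) x) - (\<Sum>i<Suc n. u t x i * pd i (\<rho> t) x))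
        - (vel_sq t x * \<rho> t x + 2 * p t x) * (\<Sum>i<Suc n. pd i (\<lambda>x. u t x i) x)"
      unfolding F'_def sum_distrib_left right_diff_distrib sum.distrib[symmetric] sum_subtractf[symmetric]
      by (rule sum.cong) (auto simp: algebra_simps)
    then show ?thesis
      unfolding td_kinetic[OF x] mom transport[OF x] divergence_free[OF x] by simp
  qed
  note cont = continuous_on_diff[OF cF' continuous_on_mult_left[OF c(4), of "2 * g"]]
  note bd = bulk_derivative[OF sol_parts(9) cont td]
  have "(\<lambda>m. ?B m (\<lambda>x. \<Sum>i<Suc n. F' i x) - 2 * g * ?B m (\<lambda>x. \<rho> t x * u t x n)) \<longlonglongrightarrow> 0 - 2 * g * buoyancy"
    by (intro tendsto_diff div tendsto_mult_left buoyancy_flux_tendsto)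
  then have "(\<lambda>m. ?B m (\<lambda>x. (\<Sum>i<Suc n. F' i x) - 2 * g * (\<rho> t x * u t x n))) \<longlonglongrightarrow> 0 - 2 * g * buoyancy"
    using box_diff[OF cF' continuous_on_mult_left[OF c(4), of "2 * g"]] by (simp add: box_cmult del: sum.lessThan_Suc)
  from LIMSEQ_unique[OF this bd(2)] bd(1) show ?thesis by simp
qed

definition dissipation :: real where
  "dissipation = strip_avg (Suc n) L (td (mixing_density \<rho>m \<rho>p \<rho>) t)"

text \<open>The mixing density is a concave quadratic in \<rho> with first derivative
  \<open>w\<close> and second derivative -2. Moving \<open>w\<close> inside the divergence of the
  diffusive flux therefore leaves twice the squared gradient, whose box integrals converge because
  the fluxes vanish in the limit.\<close>

lemma mixing_derivative:
  "((\<lambda>s. strip_avg (Suc n) L (mixing_density \<rho>m \<rho>p \<rho> s)) has_real_derivative dissipation) (at t)"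
  and dissipation_tendsto:
  "(\<lambda>m. box (- real m) (real m) (\<lambda>x. 2 * (\<Sum>i<Suc n. (pd i (\<rho> t) x)\<^sup>2))) \<longlonglongrightarrow> dissipation"
proof -
  let ?B = "\<lambda>m. box (- real m) (real m)"
  define w where "w x = \<rho>p + \<rho>m - 2 * \<rho> t x" for x
  define w' where "w' i x = 0 - (0 * \<rho> t x + 2 * pd i (\<rho> t) x)" for i x
  define h where "h x = (\<rho>p - \<rho> t x) * (\<rho> t x - \<rho>m)" for x
  define h' where "h' i x = (0 - pd i (\<rho> t) x) * (\<rho> t x - \<rho>m) + (\<rho>p - \<rho> t x) * (pd i (\<rho> t) x - 0)" for i x
  define F where "F i x = w x * pd i (\<rho> t) x - h x * u t x i" for i x
  define F' where "F' i x = (w' i x * pd i (\<rho> t) x + w x * pd i (pd i (\<rho> t)) x)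
    - (h' i x * u t x i + h x * pd i (\<lambda>x. u t x i) x)" for i x
  have w: "dir_C1 (Suc n) i w (w' i)" "dir_C1 (Suc n) i h (h' i)" if "i \<le> n" for i
    unfolding w_def[abs_def] w'_def[abs_def] h_def[abs_def] h'_def[abs_def] using that
    by (intro dir_C1_diff dir_C1_mult dir_C1_const density_C1; assumption)+
  have C1: "dir_C1 (Suc n) i (F i) (F' i)" if "i \<le> n" for i
    unfolding F_def[abs_def] F'_def[abs_def] using that
    by (intro dir_C1_diff dir_C1_mult w density_pd_C1 velocity_C1)
  have c: "continuous_on pts (\<lambda>x. w x * pd n (\<rho> t) x)" "continuous_on pts (\<lambda>x. h x * u t x n)"
    "continuous_on pts (\<lambda>x. 2 * (\<Sum>i<Suc n. (pd i (\<rho> t) x)\<^sup>2))"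
    unfolding w_def h_def by (auto intro!: continuous_intros continuous_derivatives)
  have cF': "continuous_on pts (\<lambda>x. \<Sum>i<Suc n. F' i x)"
    using C1 by (intro continuous_on_sum) (auto simp: dir_C1_def)
  have sF: "slice (F n) z = slice (\<lambda>x. w x * pd n (\<rho> t) x) z - slice (\<lambda>x. h x * u t x n) z" for z
    unfolding F_def[abs_def] by (rule slice_diff[OF c(1,2)])
  have div: "(\<lambda>m. ?B m (\<lambda>x. \<Sum>i<Suc n. F' i x)) \<longlonglongrightarrow> 0"
  proof (rule flux_divergence_tendsto[where F = F and F' = F'])
    show "dir_C1 (Suc n) i (F i) (F' i)" if "i \<le> n" for i by (rule C1[OF that])
    show "F i (x(i := x i + L)) = F i x" if "i < n" "x \<in> pts" for i x
      using that by (simp add: F_def w_def h_def periodic_fields)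
    note f = fluxes(6,7)[folded w_def h_def]
    show "(\<lambda>m. slice (F n) (real m)) \<longlonglongrightarrow> 0" "(\<lambda>m. slice (F n) (- real m)) \<longlonglongrightarrow> 0"
      unfolding sF
      using tendsto_diff[OF slice_flux_tendsto(1)[OF f(1) c(1)] slice_flux_tendsto(1)[OF f(2) c(2)]]
        tendsto_diff[OF slice_flux_tendsto(2)[OF f(1) c(1)] slice_flux_tendsto(2)[OF f(2) c(2)]]
      by simp_all
  qed
  have td: "td (mixing_density \<rho>m \<rho>p \<rho>) t x = (\<Sum>i<Suc n. F' i x) + 2 * (\<Sum>i<Suc n. (pd i (\<rho> t) x)\<^sup>2)"
    if x: "x \<in> pts" for x
  proof -
    have "(\<Sum>i<Suc n. F' i x) = w x * ((\<Sum>i<Suc n. pd i (pd i (\<rho> t)) x) - (\<Sum>i<Suc n. u t x i * pd i (\<rho> t) x))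
       - 2 * (\<Sum>i<Suc n. (pd i (\<rho> t) x)\<^sup>2) - h x * (\<Sum>i<Suc n. pd i (\<lambda>x. u t x i) x)"
      unfolding F'_def w_def w'_def h'_def sum_distrib_left right_diff_distrib[of "w x" for w]
        sum.distrib[symmetric] sum_subtractf[symmetric]
      by (rule sum.cong) (auto simp: algebra_simps power2_eq_square)
    then show ?thesis
      unfolding td_mixing[OF x] transport[OF x] divergence_free[OF x] w_def by simp
  qed
  note bd = bulk_derivative[OF sol_parts(10) continuous_on_add[OF cF' c(3)] td]
  show "((\<lambda>s. strip_avg (Suc n) L (mixing_density \<rho>m \<rho>p \<rho> s)) has_real_derivative dissipation) (at t)"
    using bd(1) by (simp add: dissipation_def)
  have "(\<lambda>m. ?B m (\<lambda>x. \<Sum>i<Suc n. F' i x) + ?B m (\<lambda>x. 2 * (\<Sum>i<Suc n. (pd i (\<rho> t) x)\<^sup>2))) \<longlonglongrightarrow> dissipation"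
    using bd(2) unfolding dissipation_def box_add[OF cF' c(3)] .
  from tendsto_diff[OF this div]
  show "(\<lambda>m. ?B m (\<lambda>x. 2 * (\<Sum>i<Suc n. (pd i (\<rho> t) x)\<^sup>2))) \<longlonglongrightarrow> dissipation"
    by (simp del: sum.lessThan_Suc)
qed

end

end

subsection \<open>Growth of the bulk quantities\<close>

text \<open>The differential inequality for the square root of \<open>E\<close> integrates to a
  bound by \<open>H\<close> plus a multiple of t, while \<open>H\<close> is bounded by the square
  root of \<open>X\<close>, hence by that of \<open>E\<close> plus a multiple of t. With the right
  weight, half of the root is absorbed on the left.\<close>

lemma quadratic_growth:
  fixes X E H W D :: "real \<Rightarrow> real"
  assumes X: "\<And>t. t > 0 \<Longrightarrow> (X has_real_derivative g * (\<Delta> - W t)) (at t)"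
    and E: "\<And>t. t > 0 \<Longrightarrow> (E has_real_derivative - 2 * g * W t) (at t)"
    and H: "\<And>t. t > 0 \<Longrightarrow> (H has_real_derivative D t) (at t)"
    and W: "\<And>t \<kappa>. t > 0 \<Longrightarrow> \<kappa> > 0 \<Longrightarrow> \<bar>W t\<bar> \<le> a3 * \<kappa> * D t + a4 * E t / \<kappa>"
    and HX: "\<And>t l. t > 0 \<Longrightarrow> l > 0 \<Longrightarrow> H t \<le> a1 * l + a2 * X t / l"
    and nonneg: "\<And>t. t > 0 \<Longrightarrow> E t \<ge> 0" "\<And>t. t > 0 \<Longrightarrow> X t \<ge> 0"
    and pos: "g > 0" "\<Delta> > 0" "a1 > 0" "a2 > 0" "a3 > 0" "a4 > 0"
  shows "\<exists>K. \<forall>t\<ge>1. X t \<le> K * t\<^sup>2 \<and> H t \<le> K * t"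
proof -
  define a where "a = a1 + a2"
  \<comment> \<open>The added 1 keeps the root differentiable and bounded away from zero where
    \<open>E\<close> vanishes.\<close>
  define b where "b t = sqrt (E t + 1)" for t
  define Y where "Y t = sqrt (X t + 1)" for t
  \<comment> \<open>Chosen so that \<open>g * \<nu> * a3 * a = 1 / 2\<close>, the coefficient with
    which \<open>b t\<close> returns on the right.\<close>
  define \<nu> where "\<nu> = 1 / (2 * g * a3 * a)"
  define c where "c = 2 * X 1 - E 1 - 2 * g * \<Delta>"
  have a: "a > 0" and \<nu>: "\<nu> > 0" using pos by (auto simp: a_def \<nu>_def)
  have energy: "2 * X t = E t + 2 * g * \<Delta> * t + c" if t: "t \<ge> 1" for t
  proof -
    define f where "f s = 2 * X s - E s - 2 * g * \<Delta> * s" for s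
    have d: "(f has_real_derivative 0) (at s)" if "s > 0" for s
    proof -
      have "(f has_real_derivative 2 * (g * (\<Delta> - W s)) - (- 2 * g * W s) - 2 * g * \<Delta>) (at s)"
        unfolding f_def[abs_def] using that by (intro DERIV_diff DERIV_cmult X E DERIV_cmult_Id)
      then show ?thesis by (simp add: algebra_simps)
    qed
    have "f t = f 1"
    proof (cases "t = 1")
      case False
      have "continuous_on {1..t} f"
        by (intro continuous_at_imp_continuous_on ballI DERIV_isCont[OF d]) simp
      then show ?thesis
        by (rule DERIV_isconst_end[rotated]) (use False t d in auto)
    qed simp
    then show ?thesis by (simp add: f_def c_def)
  qed
  have b_pos: "b t \<ge> 1" if "t > 0" for t using nonneg(1)[OF that] by (simp add: b_def)
  have b_le: "b t \<le> b 1 + g * \<nu> * a3 * (H t - H 1) + g * a4 / \<nu> * (t - 1)" if t: "t \<ge> 1" for t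
  proof -
    \<comment> \<open>The integrated differential inequality for \<open>b\<close> amounts to this
      function being nonincreasing on times after 1.\<close>
    define G where "G s = b s - g * \<nu> * a3 * H s - g * a4 / \<nu> * s" for s
    have "\<exists>y. (G has_real_derivative y) (at s) \<and> y \<le> 0" if s: "s \<ge> 1" for s
    proof -
      have s0: "s > 0" using s by simp
      have bs: "b s \<ge> 1" by (rule b_pos[OF s0])
      have sq: "sqrt (E s + 1) = b s" "E s + 1 > 0" using nonneg(1)[OF s0] by (auto simp: b_def)
      have db: "(b has_real_derivative - (g * W s / b s)) (at s)"
    proof -
      have "((\<lambda>s. E s + 1) has_real_derivative - 2 * g * W s) (at s)"
        using DERIV_add[OF E[OF s0] DERIV_const[of 1]] by simp
      from DERIV_chain2[OF DERIV_real_sqrt[OF sq(2)] this] show ?thesis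
        unfolding sq(1) using bs by (simp add: b_def[abs_def] field_simps)
    qed
      have E_b: "E s \<le> (b s)\<^sup>2" using nonneg(1)[OF s0] by (simp add: b_def)
      have "- (g * W s / b s) \<le> g / b s * \<bar>W s\<bar>"
        using pos bs by (auto simp: divide_simps abs_if mult_le_0_iff)
      \<comment> \<open>The weight \<open>\<nu> * b s\<close> makes the coefficient of
        \<open>D s\<close> constant in time, so that it integrates to \<open>H\<close>, and leaves
        \<open>E s / (b s)\<^sup>2\<close>, which is at most 1.\<close>
      also have "\<dots> \<le> g / b s * (a3 * (\<nu> * b s) * D s + a4 * E s / (\<nu> * b s))"
        using pos bs \<nu> by (intro mult_left_mono W[OF s0]) auto
      also have "\<dots> = g * \<nu> * a3 * D s + g * a4 / \<nu> * (E s / (b s)\<^sup>2)"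
      proof -
        have "b s \<noteq> 0" "\<nu> \<noteq> 0" using bs \<nu> by auto
        then show ?thesis by (simp add: field_simps power2_eq_square)
      qed
      also have "g * a4 / \<nu> * (E s / (b s)\<^sup>2) \<le> g * a4 / \<nu> * 1"
        using pos \<nu> E_b bs by (intro mult_left_mono) (auto simp: divide_le_eq_1)
      finally have le: "- (g * W s / b s) - g * \<nu> * a3 * D s - g * a4 / \<nu> \<le> 0" by simp
      have "(G has_real_derivative - (g * W s / b s) - g * \<nu> * a3 * D s - g * a4 / \<nu>) (at s)"
        unfolding G_def[abs_def] using s0 by (intro DERIV_diff DERIV_cmult db H DERIV_cmult_Id)
      with le show ?thesis by blast
    qed
    then have "G t \<le> G 1" by (rule DERIV_nonpos_imp_nonincreasing[OF t, of G]) simp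
    then show ?thesis by (simp add: G_def right_diff_distrib)
  qed
  have Y1: "Y t \<ge> 1" and HY: "H t \<le> a * Y t" if "t > 0" for t
  proof -
    show Y1: "Y t \<ge> 1" using nonneg(2)[OF that] by (simp add: Y_def)
    have "X t \<le> Y t * Y t" using nonneg(2)[OF that] by (simp add: Y_def)
    then have "X t / Y t \<le> Y t" using Y1 by (simp add: divide_le_eq)
    then have "a2 * (X t / Y t) \<le> a2 * Y t" using pos by (intro mult_left_mono) auto
    \<comment> \<open>The layer height \<open>l = Y t\<close> balances the two terms of the bound on
      \<open>H\<close>.\<close>
    then show "H t \<le> a * Y t" using HX[OF that, of "Y t"] Y1 by (simp add: a_def algebra_simps)
  qed
  \<comment> \<open>Makes \<open>k0 * t\<close>, for times after 1, at least 1 and at least the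
    linear and constant terms of the energy identity.\<close>
  define k0 where "k0 = g * \<Delta> + \<bar>c\<bar> + 1"
  have Y_le: "Y t \<le> b t + k0 * t" if t: "t \<ge> 1" for t
  proof -
    have t0: "t > 0" using t by simp
    have k: "k0 * t \<ge> g * \<Delta> * t + \<bar>c\<bar> + 1"
      using t mult_left_mono[of 1 t "\<bar>c\<bar> + 1"] by (simp add: k0_def algebra_simps)
    moreover have "g * \<Delta> * t \<ge> 0" using pos t by auto
    ultimately have k1: "k0 * t \<ge> 1" by linarith
    then have k2: "k0 * t \<le> (k0 * t)\<^sup>2" by (simp add: power2_eq_square mult_le_cancel_left1)
    have "X t + 1 \<le> (E t + 1) + k0 * t"
      using energy[OF t] k nonneg(1)[OF t0] by linarith
    also have "\<dots> \<le> (b t)\<^sup>2 + (k0 * t)\<^sup>2" using k2 nonneg(1)[OF t0] by (simp add: b_def)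
    also have "\<dots> \<le> (b t + k0 * t)\<^sup>2"
      using b_pos[OF t0] k1 by (simp add: power2_sum)
    finally have "Y t \<le> sqrt ((b t + k0 * t)\<^sup>2)" unfolding Y_def by (rule real_sqrt_le_mono)
    then show ?thesis using b_pos[OF t0] k1 by simp
  qed
  \<comment> \<open>The factor 2 comes from absorbing half of \<open>b t\<close>; the other half of
    the bound contributes \<open>k0\<close>.\<close>
  define k2 where "k2 = 2 * (b 1 + \<bar>g * \<nu> * a3 * H 1\<bar> + g * a4 / \<nu>) + k0"
  have b_lin: "b t \<le> k2 * t" if t: "t \<ge> 1" for t
  proof -
    have t0: "t > 0" using t by simp
    have half: "g * \<nu> * a3 * a = 1 / 2" using pos a by (simp add: \<nu>_def)
    have p: "g * \<nu> * a3 > 0" "g * a4 / \<nu> > 0" using pos \<nu> by auto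
    have "g * \<nu> * a3 * H t \<le> g * \<nu> * a3 * (a * (b t + k0 * t))"
      using p(1) a by (intro mult_left_mono order_trans[OF HY[OF t0]] Y_le[OF t]) auto
    also have "\<dots> = (b t + k0 * t) / 2" using half by (simp add: mult.assoc[symmetric])
    finally have "b t \<le> 2 * (b 1 + \<bar>g * \<nu> * a3 * H 1\<bar> + g * a4 / \<nu> * (t - 1)) + k0 * t"
      using b_le[OF t] by (simp add: right_diff_distrib)
    also have "\<dots> \<le> 2 * (b 1 * t + \<bar>g * \<nu> * a3 * H 1\<bar> * t + g * a4 / \<nu> * t) + k0 * t"
    proof -
      have "b 1 \<le> b 1 * t" "\<bar>g * \<nu> * a3 * H 1\<bar> \<le> \<bar>g * \<nu> * a3 * H 1\<bar> * t"
        using mult_left_mono[OF t, of "b 1"] mult_left_mono[OF t, of "\<bar>g * \<nu> * a3 * H 1\<bar>"] b_pos[of 1]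
        by simp_all
      moreover have "g * a4 / \<nu> * (t - 1) \<le> g * a4 / \<nu> * t" using p by (intro mult_left_mono) auto
      ultimately show ?thesis by (intro add_right_mono mult_left_mono add_mono) (use p in auto)
    qed
    finally show ?thesis by (simp add: k2_def algebra_simps)
  qed
  define k3 where "k3 = k2 + k0"
  have Y_lin: "Y t \<le> k3 * t" if "t \<ge> 1" for t
    using Y_le[OF that] b_lin[OF that] by (simp add: k3_def algebra_simps)
  show ?thesis
  proof (intro exI[of _ "max (k3\<^sup>2) (a * k3)"] allI impI conjI)
    fix t :: real assume t: "t \<ge> 1"
    then have t0: "t > 0" by simp
    have "X t \<le> (Y t)\<^sup>2" using nonneg(2)[OF t0] by (simp add: Y_def)
    also have "\<dots> \<le> (k3 * t)\<^sup>2" using Y_lin[OF t] Y1[OF t0] by (intro power_mono) auto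
    also have "\<dots> = k3\<^sup>2 * t\<^sup>2" by (simp add: power_mult_distrib)
    also have "\<dots> \<le> max (k3\<^sup>2) (a * k3) * t\<^sup>2" by (intro mult_right_mono) auto
    finally show "X t \<le> max (k3\<^sup>2) (a * k3) * t\<^sup>2" .
    have "H t \<le> a * Y t" by (rule HY[OF t0])
    also have "\<dots> \<le> a * (k3 * t)" using Y_lin[OF t] a by (intro mult_left_mono) auto
    also have "\<dots> = (a * k3) * t" by simp
    also have "\<dots> \<le> max (k3\<^sup>2) (a * k3) * t" using t0 by (intro mult_right_mono) auto
    finally show "H t \<le> max (k3\<^sup>2) (a * k3) * t" .
  qed
qed

section \<open>Estimates of buoyancy and mixing for the flow\<close>

context flow
begin

abbreviation potential :: "real \<Rightarrow> real" where
  "potential t \<equiv> strip_avg (Suc n) L (potential_density (Suc n) g \<rho>m \<rho>p \<rho> t)"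

abbreviation kinetic :: "real \<Rightarrow> real" where
  "kinetic t \<equiv> strip_avg (Suc n) L (kinetic_density (Suc n) \<rho> u t)"

abbreviation mixing :: "real \<Rightarrow> real" where
  "mixing t \<equiv> strip_avg (Suc n) L (mixing_density \<rho>m \<rho>p \<rho> t)"

context
  fixes t :: real
  assumes t_pos: "t > 0"
begin

lemmas field_cont = continuous_fields[OF t_pos]

lemma kinetic_eq: "kinetic_density (Suc n) \<rho> u t = (\<lambda>x. \<rho> t x * vel_sq t x)"
  by (intro ext) (simp only: kinetic_density_def L2_set_sq)

lemma vel_sq_ge: "(u t x n)\<^sup>2 \<le> vel_sq t x" "0 \<le> vel_sq t x"
  by (auto simp: vel_sq_def power2_eq_square intro!: sum_nonneg add_nonneg_nonneg)

lemma kinetic_nonneg: "x \<in> pts \<Longrightarrow> 0 \<le> \<rho> t x * vel_sq t x"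
  using density_bounds[OF t_pos, of x] \<rho>m_pos vel_sq_ge(2) by (intro mult_nonneg_nonneg) auto

lemma kinetic_integral:
  "integrable P (\<lambda>x. \<rho> t x * vel_sq t x)" "kinetic t = (\<integral>x. \<rho> t x * vel_sq t x \<partial>P)"
proof -
  have "continuous_on pts (\<lambda>x. \<rho> t x * vel_sq t x)" by (intro continuous_intros field_cont)
  note m = continuous_measurable_P[OF this]
  show "integrable P (\<lambda>x. \<rho> t x * vel_sq t x)"
    using integrable_bulk(1)[OF t_pos sol_parts(9)] m by (simp add: kinetic_eq)
  show "kinetic t = (\<integral>x. \<rho> t x * vel_sq t x \<partial>P)"
    unfolding kinetic_eq by (rule strip_avg_eq[OF m])
qed

lemma kinetic_ge_0: "0 \<le> kinetic t"
  unfolding kinetic_integral(2) by (intro integral_nonneg_AE AE_I2) (simp add: kinetic_nonneg)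

text \<open>The lower density bound turns the weighted kinetic energy into an unweighted bound,
  uniform in the box.\<close>

lemma box_vertical_velocity_le: "box a b (\<lambda>x. (u t x n)\<^sup>2) \<le> kinetic t / \<rho>m"
proof -
  have c: "continuous_on pts (\<lambda>x. \<rho>m * (u t x n)\<^sup>2)" "continuous_on pts (\<lambda>x. \<rho> t x * vel_sq t x)"
    by (auto intro!: continuous_intros field_cont)
  have "\<rho>m * box a b (\<lambda>x. (u t x n)\<^sup>2) \<le> box a b (\<lambda>x. \<rho> t x * vel_sq t x)"
    unfolding box_cmult[symmetric]
  proof (rule box_mono[OF c])
    fix x assume "x \<in> pts"
    then show "\<rho>m * (u t x n)\<^sup>2 \<le> \<rho> t x * vel_sq t x"
      using density_bounds[OF t_pos, of x] \<rho>m_pos vel_sq_ge by (intro mult_mono) auto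
  qed
  also have "\<dots> \<le> kinetic t"
    unfolding kinetic_integral(2) by (rule box_le_integral[OF kinetic_integral(1) kinetic_nonneg c(2)])
  finally show ?thesis using \<rho>m_pos by (simp add: field_simps)
qed

text \<open>By incompressibility the slice mean of the vertical velocity does not depend on the height;
  a nonzero constant would contradict the finiteness of the kinetic energy.\<close>

lemma slice_vertical_velocity: "slice (\<lambda>x. u t x n) z = 0"
proof -
  have le: "slice (\<lambda>x. u t x n) b = slice (\<lambda>x. u t x n) a" if "a \<le> b" for a b
  proof -
    have "box a b (\<lambda>x. \<Sum>i<Suc n. pd i (\<lambda>x. u t x i) x) = slice (\<lambda>x. u t x n) b - slice (\<lambda>x. u t x n) a"
      by (rule box_divergence[where F = "\<lambda>i x. u t x i"])
         (use that in \<open>auto intro: velocity_C1[OF t_pos] simp: periodic_fields[OF t_pos]\<close>)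
    moreover have "box a b (\<lambda>x. \<Sum>i<Suc n. pd i (\<lambda>x. u t x i) x) = box a b (\<lambda>x. 0)"
      by (rule box_cong[OF divergence_free[OF t_pos]])
    ultimately show ?thesis by (simp add: box_def)
  qed
  have "slice (\<lambda>x. u t x n) y = slice (\<lambda>x. u t x n) z" for y
    using le[of y z] le[of z y] by (cases "y \<le> z") auto
  then show ?thesis
    by (intro slice_const_eq_0[OF field_cont(3) _ box_vertical_velocity_le]) auto
qed

text \<open>The correlation estimate on boxes, in the limit of infinite height. One factor 1/2 comes
  from Young's inequality; the gradient term gains another because the dissipation is twice the
  squared gradient, and the velocity term gains \<open>1 / \<rho>m\<close> from the kinetic
  energy.\<close>

lemma buoyancy_le:
  assumes \<kappa>: "\<kappa> > 0"
  shows "\<bar>buoyancy t\<bar> \<le> L\<^sup>2 / 4 * \<kappa> * dissipation t + 1 / (2 * \<rho>m) * kinetic t / \<kappa>"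
proof -
  let ?D = "\<lambda>m. box (- real m) (real m) (\<lambda>x. 2 * (\<Sum>i<Suc n. (pd i (\<rho> t) x)\<^sup>2))"
  have le: "\<bar>box (- real m) (real m) (\<lambda>x. \<rho> t x * u t x n)\<bar>
      \<le> L\<^sup>2 / 4 * \<kappa> * ?D m + 1 / (2 * \<rho>m) * kinetic t / \<kappa>" for m
  proof -
    let ?B = "box (- real m) (real m)"
    \<comment> \<open>Poincare on slices uses the horizontal derivatives only; the vertical one is
      added by its sign.\<close>
    have "?B (\<lambda>x. (pd n (\<rho> t) x)\<^sup>2) \<ge> 0" unfolding box_def by (intro integral_nonneg_AE AE_I2) simp
    moreover have "?D m = 2 * (\<Sum>i<Suc n. ?B (\<lambda>x. (pd i (\<rho> t) x)\<^sup>2))"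
      unfolding box_cmult
      by (subst box_sum) (auto intro!: continuous_intros continuous_derivatives[OF t_pos])
    ultimately have grad: "(\<Sum>j<n. ?B (\<lambda>x. (pd j (\<rho> t) x)\<^sup>2)) \<le> ?D m / 2" by simp
    have "\<bar>?B (\<lambda>x. \<rho> t x * u t x n)\<bar> \<le> (\<kappa> * L\<^sup>2 * (\<Sum>j<n. ?B (\<lambda>x. (pd j (\<rho> t) x)\<^sup>2))
        + ?B (\<lambda>x. (u t x n)\<^sup>2) / \<kappa>) / 2"
    proof (rule box_correlation_le[where B = \<rho>p])
      show "\<bar>\<rho> t x\<bar> \<le> \<rho>p" if "x \<in> pts" for x using density_bounds[OF t_pos that] \<rho>m_pos by auto
    qed (use \<kappa> in \<open>auto intro: density_C1[OF t_pos] field_cont slice_vertical_velocity\<close>)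
    also have "\<dots> \<le> (\<kappa> * L\<^sup>2 * (?D m / 2) + (kinetic t / \<rho>m) / \<kappa>) / 2"
      using grad \<kappa> box_vertical_velocity_le
      by (intro divide_right_mono add_mono mult_left_mono) auto
    finally show ?thesis by (simp add: field_simps)
  qed
  show ?thesis
    by (rule LIMSEQ_le[OF tendsto_rabs[OF buoyancy_flux_tendsto[OF t_pos]]
          tendsto_add[OF tendsto_mult_left[OF dissipation_tendsto[OF t_pos]] tendsto_const]])
       (use le in blast)
qed

lemma potential_integral:
  "integrable P (potential_density (Suc n) g \<rho>m \<rho>p \<rho> t)"
  "potential t = (\<integral>x. potential_density (Suc n) g \<rho>m \<rho>p \<rho> t x \<partial>P)"
proof -
  \<comment> \<open>The reference density jumps at height 0, so measurability cannot come from
    continuity and is assembled from the parts.\<close>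
  have n[measurable]: "(\<lambda>x. x n) \<in> borel_measurable P" unfolding P_def by measurable
  have [measurable]: "\<rho> t \<in> borel_measurable P" by (rule continuous_measurable_P[OF field_cont(1)])
  have m: "potential_density (Suc n) g \<rho>m \<rho>p \<rho> t \<in> borel_measurable P"
    unfolding potential_density_def[abs_def] ref_density_def diff_Suc_1 by measurable
  show "integrable P (potential_density (Suc n) g \<rho>m \<rho>p \<rho> t)"
    by (rule integrable_bulk(1)[OF t_pos sol_parts(8) m])
  show "potential t = (\<integral>x. potential_density (Suc n) g \<rho>m \<rho>p \<rho> t x \<partial>P)"
    by (rule strip_avg_eq[OF m])
qed

text \<open>The heavy fluid lies on top in the reference state, so both the deviation of \<rho> from
  it and the height change sign at 0.\<close>

lemma potential_density_nonneg:
  assumes "x \<in> pts" shows "0 \<le> potential_density (Suc n) g \<rho>m \<rho>p \<rho> t x"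
  using density_bounds[OF t_pos assms] g_pos
  by (auto simp: potential_density_def ref_density_def mult_nonpos_nonpos mult_nonpos_nonneg)

lemma potential_ge_0: "0 \<le> potential t"
  unfolding potential_integral(2) by (intro integral_nonneg_AE AE_I2) (simp add: potential_density_nonneg)

text \<open>Far from the interface mixing costs potential energy; in the layer of height \<open>2 l\<close> around it the
  mixing density is at most a quarter of the squared density jump.\<close>

lemma mixing_le:
  assumes l: "l > 0"
  shows "mixing t \<le> (\<rho>p - \<rho>m)\<^sup>2 / 2 * l + (\<rho>p - \<rho>m) / g * potential t / l"
proof -
  let ?\<Delta> = "\<rho>p - \<rho>m" and ?pot = "potential_density (Suc n) g \<rho>m \<rho>p \<rho> t"
  have cm: "continuous_on pts (mixing_density \<rho>m \<rho>p \<rho> t)"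
    unfolding mixing_density_def[abs_def] by (intro continuous_intros field_cont)
  note m = continuous_measurable_P[OF cm]
  have i: "integrable P (mixing_density \<rho>m \<rho>p \<rho> t)"
    by (rule integrable_bulk(1)[OF t_pos sol_parts(10) m])
  have ib: "integrable P (\<lambda>x. indicator {- l..l} (x n) * (?\<Delta>\<^sup>2 / 4))"
    by (rule integrable_P_box) (rule continuous_on_const)
  have pw: "mixing_density \<rho>m \<rho>p \<rho> t x \<le> indicator {- l..l} (x n) * (?\<Delta>\<^sup>2 / 4) + ?\<Delta> / (g * l) * ?pot x"
    if x: "x \<in> pts" for x
  proof -
    have r: "\<rho>m < \<rho> t x" "\<rho> t x < \<rho>p" using density_bounds[OF t_pos x] by auto
    show ?thesis
    proof (cases "x n \<in> {- l..l}")
      case True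
      \<comment> \<open>This square is the squared jump minus four times the mixing density.\<close>
      have "0 \<le> (\<rho>p + \<rho>m - 2 * \<rho> t x)\<^sup>2" by simp
      then have "mixing_density \<rho>m \<rho>p \<rho> t x \<le> ?\<Delta>\<^sup>2 / 4"
        by (simp add: mixing_density_def power2_eq_square algebra_simps)
      moreover have "0 \<le> ?\<Delta> / (g * l) * ?pot x"
        using potential_density_nonneg[OF x] g_pos l \<rho>_less by (intro mult_nonneg_nonneg) auto
      ultimately show ?thesis using True by simp
    next
      case False
      \<comment> \<open>The absolute deviation from the reference density: \<open>?pot x\<close>
        equals it times \<open>g * \<bar>x n\<bar>\<close>, and the other factor of the mixing
        density is at most the jump.\<close>
      define \<theta> where "\<theta> = (if x n \<ge> 0 then \<rho>p - \<rho> t x else \<rho> t x - \<rho>m)"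
      have "mixing_density \<rho>m \<rho>p \<rho> t x \<le> ?\<Delta> * \<theta>"
        unfolding mixing_density_def \<theta>_def using r
        by (auto simp: mult.commute[of "?\<Delta>"] intro: mult_left_mono mult_mono)
      moreover have "\<theta> * (g * l) \<le> ?pot x"
      proof -
        have "?pot x = \<theta> * (g * \<bar>x n\<bar>)"
          by (simp add: potential_density_def ref_density_def \<theta>_def algebra_simps)
        moreover have "l \<le> \<bar>x n\<bar>" using False by auto
        moreover have "\<theta> \<ge> 0" using r by (simp add: \<theta>_def)
        ultimately show ?thesis using g_pos by (auto intro!: mult_left_mono)
      qed
      then have "\<theta> \<le> ?pot x / (g * l)" using g_pos l by (simp add: le_divide_eq)
      then have "?\<Delta> * \<theta> \<le> ?\<Delta> * (?pot x / (g * l))" using \<rho>_less by (intro mult_left_mono) auto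
      ultimately show ?thesis using False by simp
    qed
  qed
  have "mixing t = (\<integral>x. mixing_density \<rho>m \<rho>p \<rho> t x \<partial>P)" by (rule strip_avg_eq[OF m])
  also have "\<dots> \<le> (\<integral>x. indicator {- l..l} (x n) * (?\<Delta>\<^sup>2 / 4) + ?\<Delta> / (g * l) * ?pot x \<partial>P)"
    by (intro integral_mono i ib Bochner_Integration.integrable_add integrable_mult_right potential_integral(1))
       (simp only: space_P pw)
  also have "\<dots> = box (- l) l (\<lambda>x. ?\<Delta>\<^sup>2 / 4) + ?\<Delta> / (g * l) * potential t"
    unfolding potential_integral(2) box_def
    using ib potential_integral(1) by (subst Bochner_Integration.integral_add) auto
  also have "\<dots> = ?\<Delta>\<^sup>2 / 2 * l + ?\<Delta> / g * potential t / l"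
    using l by (simp add: box_const)
  finally show ?thesis .
qed

end

lemma bulk_growth: "\<exists>K. \<forall>t\<ge>1. potential t \<le> K * t\<^sup>2 \<and> mixing t \<le> K * t"
proof (rule quadratic_growth[where E = kinetic and W = buoyancy and D = dissipation and g = g
      and \<Delta> = "\<rho>p - \<rho>m" and ?a1.0 = "(\<rho>p - \<rho>m)\<^sup>2 / 2" and ?a2.0 = "(\<rho>p - \<rho>m) / g"
      and ?a3.0 = "L\<^sup>2 / 4" and ?a4.0 = "1 / (2 * \<rho>m)"])
qed (use g_pos \<rho>m_pos \<rho>_less L_pos in \<open>auto simp only: potential_derivative kinetic_derivative
  mixing_derivative buoyancy_le mixing_le kinetic_ge_0 potential_ge_0 intro!: divide_pos_pos zero_less_power\<close>)

end

section \<open>From polynomial growth to the upper limits\<close>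

lemma Limsup_le_if_tendsto_0:
  fixes f h :: "real \<Rightarrow> real"
  assumes "\<forall>\<^sub>F t in at_top. f t \<le> h t" and h: "(h \<longlongrightarrow> 0) at_top" and "B \<ge> 0"
  shows "Limsup at_top (\<lambda>t. ereal (f t)) \<le> ereal B"
proof -
  have "Limsup at_top (\<lambda>t. ereal (f t)) \<le> Limsup at_top (\<lambda>t. ereal (h t))"
    using assms(1) by (intro Limsup_mono) auto
  also have "\<dots> = ereal 0" using h by (intro lim_imp_Limsup) auto
  finally show ?thesis using \<open>B \<ge> 0\<close> by (auto intro: order_trans)
qed

theorem theorem2:
  shows "\<exists>C::real. C > 0 \<and>
    (\<forall>(d::nat) (L::real) (g::real) (\<rho>m::real) (\<rho>p::real) (A::real)
       (\<rho> :: real \<Rightarrow> (nat \<Rightarrow> real) \<Rightarrow> real)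
       (u :: real \<Rightarrow> (nat \<Rightarrow> real) \<Rightarrow> nat \<Rightarrow> real)
       (p :: real \<Rightarrow> (nat \<Rightarrow> real) \<Rightarrow> real).
       d \<ge> 2 \<and> L > 0 \<and> g > 0 \<and> \<rho>p > \<rho>m \<and> \<rho>m > 0 \<and> A = (\<rho>p - \<rho>m) / (\<rho>p + \<rho>m) \<and>
       classical_solution d L g \<rho>m \<rho>p \<rho> u p \<and>
       strip_integrable d L (potential_density d g \<rho>m \<rho>p \<rho> 0) \<and>
       strip_integrable d L (mixing_density \<rho>m \<rho>p \<rho> 0) \<and>
       mean_perimeter d L \<rho>m \<rho>p \<rho> 0 < \<infinity>
       \<longrightarrow>
       Limsup at_top (\<lambda>t::real. ereal (Ep d L g \<rho>m \<rho>p \<rho> t / (A\<^sup>2 * g ^ 3 * t ^ 3)))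
         \<le> ereal (C * (L\<^sup>2 / (1 - A) powr (3 / 2))) \<and>
       Limsup at_top (\<lambda>t::real. ereal (Hmix d L \<rho>m \<rho>p \<rho> t / (A * g * t powr (3 / 2))))
         \<le> ereal (C * (L / (1 - A) powr (3 / 4))))"
\<comment> \<open>Both quotients have upper limit at most 0 and the right-hand sides are
  nonnegative, so any positive constant serves as witness.\<close>
proof (rule exI[of _ 1], intro conjI allI impI)
  show "(1::real) > 0" by simp
next
  fix d :: nat and L g \<rho>m \<rho>p A :: real
    and \<rho> :: "real \<Rightarrow> (nat \<Rightarrow> real) \<Rightarrow> real" and u :: "real \<Rightarrow> (nat \<Rightarrow> real) \<Rightarrow> nat \<Rightarrow> real"
    and p :: "real \<Rightarrow> (nat \<Rightarrow> real) \<Rightarrow> real"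
  assume "d \<ge> 2 \<and> L > 0 \<and> g > 0 \<and> \<rho>p > \<rho>m \<and> \<rho>m > 0 \<and> A = (\<rho>p - \<rho>m) / (\<rho>p + \<rho>m) \<and>
       classical_solution d L g \<rho>m \<rho>p \<rho> u p \<and>
       strip_integrable d L (potential_density d g \<rho>m \<rho>p \<rho> 0) \<and>
       strip_integrable d L (mixing_density \<rho>m \<rho>p \<rho> 0) \<and>
       mean_perimeter d L \<rho>m \<rho>p \<rho> 0 < \<infinity>"
  then have d: "d \<ge> 2" and L: "L > 0" and g: "g > 0" and r: "\<rho>p > \<rho>m" "\<rho>m > 0"
    and A: "A = (\<rho>p - \<rho>m) / (\<rho>p + \<rho>m)" and sol: "classical_solution d L g \<rho>m \<rho>p \<rho> u p" by auto
  define n where "n = d - 1"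
  have dn: "d = Suc n" using d by (simp add: n_def)
  interpret flow n L g \<rho>m \<rho>p \<rho> u p
    by unfold_locales (use L g r sol dn in auto)
  obtain K where K: "\<And>t. t \<ge> 1 \<Longrightarrow> potential t \<le> K * t\<^sup>2" "\<And>t. t \<ge> 1 \<Longrightarrow> mixing t \<le> K * t"
    using bulk_growth by blast
  define \<Delta> where "\<Delta> = \<rho>p - \<rho>m"
  have \<Delta>: "\<Delta> > 0" and A0: "A > 0" using r by (auto simp: \<Delta>_def A)
  show "Limsup at_top (\<lambda>t::real. ereal (Ep d L g \<rho>m \<rho>p \<rho> t / (A\<^sup>2 * g ^ 3 * t ^ 3)))
         \<le> ereal (1 * (L\<^sup>2 / (1 - A) powr (3 / 2)))"
  proof (rule Limsup_le_if_tendsto_0)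
    \<comment> \<open>Quadratic growth against the cube of t leaves 1/t; in the second bound, linear
      growth against the power 3/2 leaves the power -1/2.\<close>
    show "\<forall>\<^sub>F t in at_top. Ep d L g \<rho>m \<rho>p \<rho> t / (A\<^sup>2 * g ^ 3 * t ^ 3) \<le> K / (\<Delta> * A\<^sup>2 * g ^ 3) * (1 / t)"
      using eventually_ge_at_top[of 1]
    proof eventually_elim
      fix t :: real assume t: "t \<ge> 1"
      have "Ep d L g \<rho>m \<rho>p \<rho> t / (A\<^sup>2 * g ^ 3 * t ^ 3) \<le> (1 / \<Delta> * (K * t\<^sup>2)) / (A\<^sup>2 * g ^ 3 * t ^ 3)"
        unfolding Ep_def dn \<Delta>_def[symmetric] using K(1)[OF t] \<Delta> A0 g t
        by (intro divide_right_mono mult_left_mono) auto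
      also have "\<dots> = K / (\<Delta> * A\<^sup>2 * g ^ 3) * (1 / t)"
        using t by (simp add: power2_eq_square power3_eq_cube)
      finally show "Ep d L g \<rho>m \<rho>p \<rho> t / (A\<^sup>2 * g ^ 3 * t ^ 3) \<le> K / (\<Delta> * A\<^sup>2 * g ^ 3) * (1 / t)" .
    qed
    show "((\<lambda>t::real. K / (\<Delta> * A\<^sup>2 * g ^ 3) * (1 / t)) \<longlongrightarrow> 0) at_top"
      by (intro tendsto_mult_right_zero tendsto_divide_0[OF tendsto_const] filterlim_at_top_imp_at_infinity filterlim_ident)
  qed simp
  show "Limsup at_top (\<lambda>t::real. ereal (Hmix d L \<rho>m \<rho>p \<rho> t / (A * g * t powr (3 / 2))))
         \<le> ereal (1 * (L / (1 - A) powr (3 / 4)))"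
  proof (rule Limsup_le_if_tendsto_0)
    show "\<forall>\<^sub>F t in at_top. Hmix d L \<rho>m \<rho>p \<rho> t / (A * g * t powr (3 / 2)) \<le> K / (\<Delta>\<^sup>2 * A * g) * t powr (- (1 / 2))"
      using eventually_ge_at_top[of 1]
    proof eventually_elim
      fix t :: real assume t: "t \<ge> 1"
      have "Hmix d L \<rho>m \<rho>p \<rho> t / (A * g * t powr (3 / 2)) \<le> (1 / \<Delta>\<^sup>2 * (K * t)) / (A * g * t powr (3 / 2))"
        unfolding Hmix_def dn \<Delta>_def[symmetric] using K(2)[OF t] \<Delta> A0 g t
        by (intro divide_right_mono mult_left_mono) auto
      also have "\<dots> = K / (\<Delta>\<^sup>2 * A * g) * (t powr 1 / t powr (3 / 2))"
        using t by simp
      also have "t powr 1 / t powr (3 / 2) = t powr (- (1 / 2))"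
        unfolding powr_diff[symmetric] by simp
      finally show "Hmix d L \<rho>m \<rho>p \<rho> t / (A * g * t powr (3 / 2)) \<le> K / (\<Delta>\<^sup>2 * A * g) * t powr (- (1 / 2))" .
    qed
    show "((\<lambda>t::real. K / (\<Delta>\<^sup>2 * A * g) * t powr (- (1 / 2))) \<longlongrightarrow> 0) at_top"
      by (intro tendsto_mult_right_zero tendsto_neg_powr filterlim_ident) simp
  qed (use L in simp)
qed

end
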